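(* Let $(C,\overline{\otimes},e)$ be a closed symmetric monoidal category with finite limits and colimits. If $X$ and $Y$ are nuclear in $\mathrm{Ind}(C)$ then so is $X\overline{\otimes}Y$.
   Context: $\underline{\mathrm{Hom}}$ denotes the internal Hom; the main example is $C=\mathrm{Ban}_R$, the category of Banach modules over a Banach ring $R$ with bounded $R$-linear maps and the completed projective tensor product. $\mathrm{Ind}(C)$ is the ind-completion of $C$ with the extended closed symmetric monoidal structure $(\text{``}\mathrm{colim}"_iE_i)\overline{\otimes}(\text{``}\mathrm{colim}"_jF_j)=\text{``}\mathrm{colim}"_{(i,j)}E_i\overline{\otimes}F_j$ and $\underline{\mathrm{Hom}}(\text{``}\mathrm{colim}"_iE_i,\text{``}\mathrm{colim}"_jF_j)=\lim_i\text{``}\mathrm{colim}"_j\underline{\mathrm{Hom}}(E_i,F_j)$. For an object $W$ of $C$, $W^\vee=\underline{\mathrm{Hom}}(W,e)$. An object $V$ of $\mathrm{Ind}(C)$ is nuclear if for every object $W$ of $C$ the natural morphism $W^\vee\overline{\otimes}V\to\underline{\mathrm{Hom}}(W,V)$ is an isomorphism. *)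

theory Defs
  imports Main
begin

section \<open>Categories, diagrams, finite limits and colimits\<close>

record ('o, 'a) cat =
  Obj :: "'o set"
  Arr :: "'a set"
  Dom :: "'a \<Rightarrow> 'o"
  Cod :: "'a \<Rightarrow> 'o"
  Id :: "'o \<Rightarrow> 'a"
  Comp :: "'a \<Rightarrow> 'a \<Rightarrow> 'a"  (infixr "\<cdot>\<index>" 75)

definition hom :: "('o, 'a, 'z) cat_scheme \<Rightarrow> 'o \<Rightarrow> 'o \<Rightarrow> 'a set" where
  "hom C A B = {f \<in> Arr C. Dom C f = A \<and> Cod C f = B}"

locale category =
  fixes C :: "('o, 'a, 'z) cat_scheme" (structure)
  assumes Dom_in_Obj: "f \<in> Arr C \<Longrightarrow> Dom C f \<in> Obj C"
    and Cod_in_Obj: "f \<in> Arr C \<Longrightarrow> Cod C f \<in> Obj C"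
    and Id_in_hom: "A \<in> Obj C \<Longrightarrow> Id C A \<in> hom C A A"
    and Comp_in_hom: "f \<in> hom C A B \<Longrightarrow> g \<in> hom C B D \<Longrightarrow> g \<cdot> f \<in> hom C A D"
    and Comp_Id: "f \<in> hom C A B \<Longrightarrow> f \<cdot> Id C A = f"
    and Id_Comp: "f \<in> hom C A B \<Longrightarrow> Id C B \<cdot> f = f"
    and Comp_assoc:
      "f \<in> hom C A B \<Longrightarrow> g \<in> hom C B D \<Longrightarrow> h \<in> hom C D E \<Longrightarrow> (h \<cdot> g) \<cdot> f = h \<cdot> (g \<cdot> f)"

definition iso :: "('o, 'a, 'z) cat_scheme \<Rightarrow> 'o \<Rightarrow> 'o \<Rightarrow> 'a \<Rightarrow> bool" where
  "iso C A B f \<longleftrightarrow> f \<in> hom C A B \<and>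
     (\<exists>g \<in> hom C B A. g \<cdot>\<^bsub>C\<^esub> f = Id C A \<and> f \<cdot>\<^bsub>C\<^esub> g = Id C B)"

text \<open>A diagram is a functor together with its index category.\<close>

record ('i, 'm, 'o, 'a) diagram =
  Idx :: "('i, 'm) cat"
  ob :: "'i \<Rightarrow> 'o"
  ar :: "'m \<Rightarrow> 'a"

definition is_diagram :: "('o, 'a, 'z) cat_scheme \<Rightarrow> ('i, 'm, 'o, 'a) diagram \<Rightarrow> bool" where
  "is_diagram C D \<longleftrightarrow> category (Idx D) \<and>
     (\<forall>i \<in> Obj (Idx D). ob D i \<in> Obj C) \<and>
     (\<forall>u \<in> Arr (Idx D). ar D u \<in> hom C (ob D (Dom (Idx D) u)) (ob D (Cod (Idx D) u))) \<and>
     (\<forall>i \<in> Obj (Idx D). ar D (Id (Idx D) i) = Id C (ob D i)) \<and>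
     (\<forall>i j k. \<forall>u \<in> hom (Idx D) i j. \<forall>v \<in> hom (Idx D) j k.
        ar D (v \<cdot>\<^bsub>Idx D\<^esub> u) = ar D v \<cdot>\<^bsub>C\<^esub> ar D u)"

definition is_cone ::
  "('o, 'a, 'z) cat_scheme \<Rightarrow> ('i, 'm, 'o, 'a) diagram \<Rightarrow> 'o \<Rightarrow> ('i \<Rightarrow> 'a) \<Rightarrow> bool" where
  "is_cone C D L p \<longleftrightarrow> L \<in> Obj C \<and> (\<forall>i \<in> Obj (Idx D). p i \<in> hom C L (ob D i)) \<and>
     (\<forall>u \<in> Arr (Idx D). ar D u \<cdot>\<^bsub>C\<^esub> p (Dom (Idx D) u) = p (Cod (Idx D) u))"

definition is_cocone ::
  "('o, 'a, 'z) cat_scheme \<Rightarrow> ('i, 'm, 'o, 'a) diagram \<Rightarrow> 'o \<Rightarrow> ('i \<Rightarrow> 'a) \<Rightarrow> bool" where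
  "is_cocone C D L p \<longleftrightarrow> L \<in> Obj C \<and> (\<forall>i \<in> Obj (Idx D). p i \<in> hom C (ob D i) L) \<and>
     (\<forall>u \<in> Arr (Idx D). p (Cod (Idx D) u) \<cdot>\<^bsub>C\<^esub> ar D u = p (Dom (Idx D) u))"

definition is_limit ::
  "('o, 'a, 'z) cat_scheme \<Rightarrow> ('i, 'm, 'o, 'a) diagram \<Rightarrow> 'o \<Rightarrow> ('i \<Rightarrow> 'a) \<Rightarrow> bool" where
  "is_limit C D L p \<longleftrightarrow> is_cone C D L p \<and>
     (\<forall>M q. is_cone C D M q \<longrightarrow>
        (\<exists>!h. h \<in> hom C M L \<and> (\<forall>i \<in> Obj (Idx D). p i \<cdot>\<^bsub>C\<^esub> h = q i)))"

definition is_colimit ::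
  "('o, 'a, 'z) cat_scheme \<Rightarrow> ('i, 'm, 'o, 'a) diagram \<Rightarrow> 'o \<Rightarrow> ('i \<Rightarrow> 'a) \<Rightarrow> bool" where
  "is_colimit C D L p \<longleftrightarrow> is_cocone C D L p \<and>
     (\<forall>M q. is_cocone C D M q \<longrightarrow>
        (\<exists>!h. h \<in> hom C L M \<and> (\<forall>i \<in> Obj (Idx D). h \<cdot>\<^bsub>C\<^esub> p i = q i)))"

text \<open>Every finite category is isomorphic to one whose objects and arrows are natural numbers,
  so it suffices to quantify over index categories of type \<open>(nat, nat) cat\<close>.\<close>

definition has_finite_limits :: "('o, 'a, 'z) cat_scheme \<Rightarrow> bool" where
  "has_finite_limits C \<longleftrightarrow> (\<forall>D :: (nat, nat, 'o, 'a) diagram.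
     is_diagram C D \<and> finite (Obj (Idx D)) \<and> finite (Arr (Idx D)) \<longrightarrow> (\<exists>L p. is_limit C D L p))"

definition has_finite_colimits :: "('o, 'a, 'z) cat_scheme \<Rightarrow> bool" where
  "has_finite_colimits C \<longleftrightarrow> (\<forall>D :: (nat, nat, 'o, 'a) diagram.
     is_diagram C D \<and> finite (Obj (Idx D)) \<and> finite (Arr (Idx D)) \<longrightarrow> (\<exists>L p. is_colimit C D L p))"


section \<open>Closed symmetric monoidal categories\<close>

record ('o, 'a) csm_cat = "('o, 'a) cat" +
  tens :: "'o \<Rightarrow> 'o \<Rightarrow> 'o"  (infixr "\<otimes>\<index>" 80)
  tens_arr :: "'a \<Rightarrow> 'a \<Rightarrow> 'a"  (infixr "\<star>\<index>" 80)
  unit :: 'o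
  assoc :: "'o \<Rightarrow> 'o \<Rightarrow> 'o \<Rightarrow> 'a"
  lunit :: "'o \<Rightarrow> 'a"
  runit :: "'o \<Rightarrow> 'a"
  braid :: "'o \<Rightarrow> 'o \<Rightarrow> 'a"
  ihom :: "'o \<Rightarrow> 'o \<Rightarrow> 'o"
  eval :: "'o \<Rightarrow> 'o \<Rightarrow> 'a"

locale symmetric_monoidal_category = category C
  for C :: "('o, 'a, 'z) csm_cat_scheme" (structure) +
  assumes tens_in_Obj: "A \<in> Obj C \<Longrightarrow> B \<in> Obj C \<Longrightarrow> A \<otimes> B \<in> Obj C"
    and tens_arr_in_hom:
      "f \<in> hom C A B \<Longrightarrow> g \<in> hom C A' B' \<Longrightarrow> f \<star> g \<in> hom C (A \<otimes> A') (B \<otimes> B')"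
    and tens_Id: "A \<in> Obj C \<Longrightarrow> B \<in> Obj C \<Longrightarrow> Id C A \<star> Id C B = Id C (A \<otimes> B)"
    and tens_Comp:
      "f \<in> hom C A B \<Longrightarrow> g \<in> hom C B D \<Longrightarrow> f' \<in> hom C A' B' \<Longrightarrow> g' \<in> hom C B' D' \<Longrightarrow>
       (g \<cdot> f) \<star> (g' \<cdot> f') = (g \<star> g') \<cdot> (f \<star> f')"
    and unit_in_Obj: "unit C \<in> Obj C"
    and assoc_iso:
      "A \<in> Obj C \<Longrightarrow> B \<in> Obj C \<Longrightarrow> D \<in> Obj C \<Longrightarrow>
       iso C ((A \<otimes> B) \<otimes> D) (A \<otimes> (B \<otimes> D)) (assoc C A B D)"
    and assoc_natural:
      "f \<in> hom C A A' \<Longrightarrow> g \<in> hom C B B' \<Longrightarrow> h \<in> hom C D D' \<Longrightarrow>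
       assoc C A' B' D' \<cdot> ((f \<star> g) \<star> h) = (f \<star> (g \<star> h)) \<cdot> assoc C A B D"
    and lunit_iso: "A \<in> Obj C \<Longrightarrow> iso C (unit C \<otimes> A) A (lunit C A)"
    and lunit_natural: "f \<in> hom C A B \<Longrightarrow> lunit C B \<cdot> (Id C (unit C) \<star> f) = f \<cdot> lunit C A"
    and runit_iso: "A \<in> Obj C \<Longrightarrow> iso C (A \<otimes> unit C) A (runit C A)"
    and runit_natural: "f \<in> hom C A B \<Longrightarrow> runit C B \<cdot> (f \<star> Id C (unit C)) = f \<cdot> runit C A"
    and pentagon:
      "A \<in> Obj C \<Longrightarrow> B \<in> Obj C \<Longrightarrow> D \<in> Obj C \<Longrightarrow> E \<in> Obj C \<Longrightarrow>
       assoc C A B (D \<otimes> E) \<cdot> assoc C (A \<otimes> B) D E =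
       (Id C A \<star> assoc C B D E) \<cdot> assoc C A (B \<otimes> D) E \<cdot> (assoc C A B D \<star> Id C E)"
    and triangle:
      "A \<in> Obj C \<Longrightarrow> B \<in> Obj C \<Longrightarrow>
       (Id C A \<star> lunit C B) \<cdot> assoc C A (unit C) B = runit C A \<star> Id C B"
    and braid_in_hom: "A \<in> Obj C \<Longrightarrow> B \<in> Obj C \<Longrightarrow> braid C A B \<in> hom C (A \<otimes> B) (B \<otimes> A)"
    and braid_natural:
      "f \<in> hom C A A' \<Longrightarrow> g \<in> hom C B B' \<Longrightarrow>
       braid C A' B' \<cdot> (f \<star> g) = (g \<star> f) \<cdot> braid C A B"
    and braid_symmetric:
      "A \<in> Obj C \<Longrightarrow> B \<in> Obj C \<Longrightarrow> braid C B A \<cdot> braid C A B = Id C (A \<otimes> B)"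
    and hexagon:
      "A \<in> Obj C \<Longrightarrow> B \<in> Obj C \<Longrightarrow> D \<in> Obj C \<Longrightarrow>
       assoc C B D A \<cdot> braid C A (B \<otimes> D) \<cdot> assoc C A B D =
       (Id C B \<star> braid C A D) \<cdot> assoc C B A D \<cdot> (braid C A B \<star> Id C D)"

text \<open>\<open>ihom C A B\<close> is the internal Hom from \<open>A\<close> to \<open>B\<close>; the functor \<open>ihom C A\<close> is right adjoint to
  \<open>- \<otimes> A\<close> with counit \<open>eval C A\<close>.\<close>

locale closed_symmetric_monoidal_category = symmetric_monoidal_category C
  for C :: "('o, 'a, 'z) csm_cat_scheme" (structure) +
  assumes ihom_in_Obj: "A \<in> Obj C \<Longrightarrow> B \<in> Obj C \<Longrightarrow> ihom C A B \<in> Obj C"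
    and eval_in_hom: "A \<in> Obj C \<Longrightarrow> B \<in> Obj C \<Longrightarrow> eval C A B \<in> hom C (ihom C A B \<otimes> A) B"
    and eval_universal:
      "Z \<in> Obj C \<Longrightarrow> A \<in> Obj C \<Longrightarrow> B \<in> Obj C \<Longrightarrow> f \<in> hom C (Z \<otimes> A) B \<Longrightarrow>
       \<exists>!g. g \<in> hom C Z (ihom C A B) \<and> eval C A B \<cdot> (g \<star> Id C A) = f"

definition curry ::
  "('o, 'a, 'z) csm_cat_scheme \<Rightarrow> 'o \<Rightarrow> 'o \<Rightarrow> 'o \<Rightarrow> 'a \<Rightarrow> 'a" where
  "curry C Z A B f =
     (THE g. g \<in> hom C Z (ihom C A B) \<and> eval C A B \<cdot>\<^bsub>C\<^esub> (g \<star>\<^bsub>C\<^esub> Id C A) = f)"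

definition ihom_arr :: "('o, 'a, 'z) csm_cat_scheme \<Rightarrow> 'o \<Rightarrow> 'a \<Rightarrow> 'a" where
  "ihom_arr C W f =
     curry C (ihom C W (Dom C f)) W (Cod C f) (f \<cdot>\<^bsub>C\<^esub> eval C W (Dom C f))"

definition dual :: "('o, 'a, 'z) csm_cat_scheme \<Rightarrow> 'o \<Rightarrow> 'o" where
  "dual C W = ihom C W (unit C)"

text \<open>The natural morphism \<open>dual C W \<otimes> A \<rightarrow> ihom C W A\<close> is the transpose of
  \<open>(W\<^sup>\<or> \<otimes> A) \<otimes> W \<rightarrow> (A \<otimes> W\<^sup>\<or>) \<otimes> W \<rightarrow> A \<otimes> (W\<^sup>\<or> \<otimes> W) \<rightarrow> A \<otimes> e \<rightarrow> A\<close>.\<close>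

definition nat_map :: "('o, 'a, 'z) csm_cat_scheme \<Rightarrow> 'o \<Rightarrow> 'o \<Rightarrow> 'a" where
  "nat_map C W A = curry C (dual C W \<otimes>\<^bsub>C\<^esub> A) W A
     (runit C A \<cdot>\<^bsub>C\<^esub> (Id C A \<star>\<^bsub>C\<^esub> eval C W (unit C)) \<cdot>\<^bsub>C\<^esub>
      assoc C A (dual C W) W \<cdot>\<^bsub>C\<^esub> (braid C (dual C W) A \<star>\<^bsub>C\<^esub> Id C W))"


section \<open>The ind-completion\<close>

definition filtered :: "('i, 'm) cat \<Rightarrow> bool" where
  "filtered I \<longleftrightarrow> category I \<and> Obj I \<noteq> {} \<and>
     (\<forall>i \<in> Obj I. \<forall>j \<in> Obj I. \<exists>k \<in> Obj I. hom I i k \<noteq> {} \<and> hom I j k \<noteq> {}) \<and>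
     (\<forall>i j. \<forall>u \<in> hom I i j. \<forall>v \<in> hom I i j. \<exists>k. \<exists>w \<in> hom I j k. w \<cdot>\<^bsub>I\<^esub> u = w \<cdot>\<^bsub>I\<^esub> v)"

text \<open>An object of \<open>Ind(C)\<close> is a diagram in \<open>C\<close> with filtered index category. Index
  categories live in arbitrary types, and the notions below relate ind-objects whose index types
  differ; a small index category is thus one that lives in some HOL type.\<close>

definition ind_object :: "('o, 'a, 'z) cat_scheme \<Rightarrow> ('i, 'm, 'o, 'a) diagram \<Rightarrow> bool" where
  "ind_object C X \<longleftrightarrow> is_diagram C X \<and> filtered (Idx X)"

text \<open>\<open>germs C A Y\<close> is the filtered colimit of sets \<open>colim\<^sub>j Hom(A, Y\<^sub>j)\<close>: its elements are the classes
  \<open>germ C A Y j f\<close> of arrows \<open>f : A \<rightarrow> Y\<^sub>j\<close>, two of them being identified if they become equal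
  at a later stage.\<close>

definition germ ::
  "('o, 'a, 'z) cat_scheme \<Rightarrow> 'o \<Rightarrow> ('j, 'n, 'o, 'a) diagram \<Rightarrow> 'j \<Rightarrow> 'a \<Rightarrow> ('j \<times> 'a) set" where
  "germ C A Y j f = {(k, g). k \<in> Obj (Idx Y) \<and> g \<in> hom C A (ob Y k) \<and>
     (\<exists>l. \<exists>u \<in> hom (Idx Y) j l. \<exists>v \<in> hom (Idx Y) k l. ar Y u \<cdot>\<^bsub>C\<^esub> f = ar Y v \<cdot>\<^bsub>C\<^esub> g)}"

definition germs ::
  "('o, 'a, 'z) cat_scheme \<Rightarrow> 'o \<Rightarrow> ('j, 'n, 'o, 'a) diagram \<Rightarrow> ('j \<times> 'a) set set" where
  "germs C A Y = {germ C A Y j f | j f. j \<in> Obj (Idx Y) \<and> f \<in> hom C A (ob Y j)}"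

text \<open>\<open>Hom(X, Y) = lim\<^sub>i colim\<^sub>j Hom(X\<^sub>i, Y\<^sub>j)\<close>: a morphism is a compatible family of germs, normalised
  to be empty outside the index category so that equality of functions is equality of morphisms.\<close>

definition ind_hom ::
  "('o, 'a, 'z) cat_scheme \<Rightarrow> ('i, 'm, 'o, 'a) diagram \<Rightarrow> ('j, 'n, 'o, 'a) diagram \<Rightarrow>
   ('i \<Rightarrow> ('j \<times> 'a) set) set" where
  "ind_hom C X Y = {\<phi>.
     (\<forall>i \<in> Obj (Idx X). \<phi> i \<in> germs C (ob X i) Y) \<and>
     (\<forall>u \<in> Arr (Idx X). \<forall>(j, f) \<in> \<phi> (Cod (Idx X) u).
        (j, f \<cdot>\<^bsub>C\<^esub> ar X u) \<in> \<phi> (Dom (Idx X) u)) \<and>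
     (\<forall>i. i \<notin> Obj (Idx X) \<longrightarrow> \<phi> i = {})}"

definition ind_id ::
  "('o, 'a, 'z) cat_scheme \<Rightarrow> ('i, 'm, 'o, 'a) diagram \<Rightarrow> 'i \<Rightarrow> ('i \<times> 'a) set" where
  "ind_id C X = (\<lambda>i. if i \<in> Obj (Idx X) then germ C (ob X i) X i (Id C (ob X i)) else {})"

text \<open>The composite of \<open>\<phi> : X \<rightarrow> Y\<close> and \<open>\<psi> : Y \<rightarrow> Z\<close>; the union is over representatives, all of which
  give the same germ.\<close>

definition ind_comp ::
  "('o, 'a, 'z) cat_scheme \<Rightarrow> ('i, 'm, 'o, 'a) diagram \<Rightarrow> ('k, 'l, 'o, 'a) diagram \<Rightarrow>
   ('j \<Rightarrow> ('k \<times> 'a) set) \<Rightarrow> ('i \<Rightarrow> ('j \<times> 'a) set) \<Rightarrow> 'i \<Rightarrow> ('k \<times> 'a) set" where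
  "ind_comp C X Z \<psi> \<phi> =
     (\<lambda>i. \<Union>(j, f) \<in> \<phi> i. \<Union>(k, g) \<in> \<psi> j. germ C (ob X i) Z k (g \<cdot>\<^bsub>C\<^esub> f))"

definition ind_iso ::
  "('o, 'a, 'z) cat_scheme \<Rightarrow> ('i, 'm, 'o, 'a) diagram \<Rightarrow> ('j, 'n, 'o, 'a) diagram \<Rightarrow>
   ('i \<Rightarrow> ('j \<times> 'a) set) \<Rightarrow> bool" where
  "ind_iso C X Y \<phi> \<longleftrightarrow> \<phi> \<in> ind_hom C X Y \<and>
     (\<exists>\<psi> \<in> ind_hom C Y X. ind_comp C X X \<psi> \<phi> = ind_id C X \<and> ind_comp C Y Y \<phi> \<psi> = ind_id C Y)"

definition one_cat :: "(unit, unit) cat" where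
  "one_cat = \<lparr>Obj = UNIV, Arr = UNIV, Dom = (\<lambda>_. ()), Cod = (\<lambda>_. ()), Id = (\<lambda>_. ()),
     Comp = (\<lambda>_ _. ())\<rparr>"

definition prod_cat :: "('i, 'm) cat \<Rightarrow> ('j, 'n) cat \<Rightarrow> ('i \<times> 'j, 'm \<times> 'n) cat" where
  "prod_cat I J = \<lparr>Obj = Obj I \<times> Obj J, Arr = Arr I \<times> Arr J,
     Dom = map_prod (Dom I) (Dom J), Cod = map_prod (Cod I) (Cod J),
     Id = map_prod (Id I) (Id J),
     Comp = (\<lambda>(v, v') (u, u'). (v \<cdot>\<^bsub>I\<^esub> u, v' \<cdot>\<^bsub>J\<^esub> u'))\<rparr>"

text \<open>The embedding of \<open>C\<close> into \<open>Ind(C)\<close>.\<close>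

definition ind_of :: "('o, 'a, 'z) cat_scheme \<Rightarrow> 'o \<Rightarrow> (unit, unit, 'o, 'a) diagram" where
  "ind_of C A = \<lparr>Idx = one_cat, ob = (\<lambda>_. A), ar = (\<lambda>_. Id C A)\<rparr>"

definition ind_tens ::
  "('o, 'a, 'z) csm_cat_scheme \<Rightarrow> ('i, 'm, 'o, 'a) diagram \<Rightarrow> ('j, 'n, 'o, 'a) diagram \<Rightarrow>
   ('i \<times> 'j, 'm \<times> 'n, 'o, 'a) diagram" where
  "ind_tens C X Y = \<lparr>Idx = prod_cat (Idx X) (Idx Y),
     ob = (\<lambda>(i, j). ob X i \<otimes>\<^bsub>C\<^esub> ob Y j), ar = (\<lambda>(u, v). ar X u \<star>\<^bsub>C\<^esub> ar Y v)\<rparr>"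

text \<open>The internal Hom of \<open>Ind(C)\<close> from an object \<open>W\<close> of \<open>C\<close> to an ind-object \<open>V\<close>. The
  general formula \<open>lim\<^sub>i "colim"\<^sub>j ihom(E\<^sub>i, F\<^sub>j)\<close> is needed only for \<open>E = ind_of C W\<close>, where the limit is
  over a one-object index category.\<close>

definition ind_ihom ::
  "('o, 'a, 'z) csm_cat_scheme \<Rightarrow> 'o \<Rightarrow> ('j, 'n, 'o, 'a) diagram \<Rightarrow> ('j, 'n, 'o, 'a) diagram" where
  "ind_ihom C W V = \<lparr>Idx = Idx V, ob = (\<lambda>j. ihom C W (ob V j)), ar = (\<lambda>v. ihom_arr C W (ar V v))\<rparr>"

text \<open>The natural morphism from \<open>ind_tens C (ind_of C (dual C W)) V\<close> to \<open>ind_ihom C W V\<close>,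
  induced by the natural morphisms for the objects \<open>V\<^sub>j\<close>.\<close>

definition ind_nat_map ::
  "('o, 'a, 'z) csm_cat_scheme \<Rightarrow> 'o \<Rightarrow> ('j, 'n, 'o, 'a) diagram \<Rightarrow>
   unit \<times> 'j \<Rightarrow> ('j \<times> 'a) set" where
  "ind_nat_map C W V = (\<lambda>(_, j). if j \<in> Obj (Idx V)
     then germ C (dual C W \<otimes>\<^bsub>C\<^esub> ob V j) (ind_ihom C W V) j (nat_map C W (ob V j)) else {})"

definition nuclear :: "('o, 'a, 'z) csm_cat_scheme \<Rightarrow> ('j, 'n, 'o, 'a) diagram \<Rightarrow> bool" where
  "nuclear C V \<longleftrightarrow> ind_object C V \<and>
     (\<forall>W \<in> Obj C.
        ind_iso C (ind_tens C (ind_of C (dual C W)) V) (ind_ihom C W V) (ind_nat_map C W V))"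

end

theory Submission
  imports Defs
begin

text \<open>Nuclearity of an ind-object can be tested on its transition maps. Call \<open>u : A \<rightarrow> B\<close> trace class if
  there are an object \<open>D\<close> and morphisms \<open>\<epsilon> : D \<otimes> A \<rightarrow> e\<close> and \<open>t : e \<rightarrow> B \<otimes> D\<close> such that \<open>u\<close> is the composite
  \<open>A \<cong> e \<otimes> A \<rightarrow> B \<otimes> D \<otimes> A \<rightarrow> B \<otimes> e \<cong> B\<close>. Then \<open>V\<close> is nuclear if and only if every \<open>V\<^sub>i\<close> has a transition map
  \<open>V\<^sub>i \<rightarrow> V\<^sub>k\<close> that is trace class (\<open>nuclear_iff_trace_class\<close>).

  Indeed, the natural morphism \<open>W\<^sup>\<or> \<otimes> V \<rightarrow> ihom(W, V)\<close> is given levelwise, and such a morphism is invertible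
  if and only if for every \<open>i\<close> there are an index arrow \<open>i \<rightarrow> k\<close> and a morphism \<open>ihom(W, V\<^sub>i) \<rightarrow> W\<^sup>\<or> \<otimes> V\<^sub>k\<close>
  whose composites with the natural morphisms at the levels \<open>i\<close> and \<open>k\<close> are the transition maps. If \<open>V\<close> is nuclear, take \<open>W = V\<^sub>i\<close>: the identity of \<open>V\<^sub>i\<close> is a morphism
  \<open>e \<rightarrow> ihom(V\<^sub>i, V\<^sub>i)\<close>, and its image in \<open>V\<^sub>i\<^sup>\<or> \<otimes> V\<^sub>k\<close> exhibits \<open>V\<^sub>i \<rightarrow> V\<^sub>k\<close> as trace class
  (\<open>trace_class_of_factorization\<close>). Conversely, if \<open>D\<close>, \<open>\<epsilon>\<close>, \<open>t\<close> exhibit \<open>V\<^sub>i \<rightarrow> V\<^sub>k\<close> as trace class, then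
  \<open>ihom(W, V\<^sub>i) \<rightarrow> V\<^sub>k \<otimes> D \<otimes> ihom(W, V\<^sub>i) \<rightarrow> V\<^sub>k \<otimes> W\<^sup>\<or>\<close> is the required factorization
  (\<open>factorization_of_trace_class\<close>).

  The theorem follows because the tensor product of two trace-class morphisms is trace class
  (\<open>trace_class_tens\<close>): nesting \<open>t' : e \<rightarrow> Y' \<otimes> E\<close> inside \<open>t : e \<rightarrow> X' \<otimes> D\<close> gives \<open>e \<rightarrow> X' \<otimes> Y' \<otimes> E \<otimes> D\<close>, and
  nesting \<open>\<epsilon>\<close> inside \<open>\<epsilon>'\<close> gives \<open>E \<otimes> D \<otimes> X \<otimes> Y \<rightarrow> e\<close>. With this nesting no braiding occurs, so that only
  the coherence of associators and units has to be verified.\<close>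

section \<open>Calculating with arrows\<close>

lemma in_hom_iff [simp]: "f \<in> hom C A B \<longleftrightarrow> f \<in> Arr C \<and> Dom C f = A \<and> Cod C f = B"
  by (simp add: hom_def)

text \<open>The inverse of an isomorphism; on other arrows the value is arbitrary.\<close>

definition inv_arr :: "('o, 'a, 'z) cat_scheme \<Rightarrow> 'a \<Rightarrow> 'a" where
  "inv_arr C f = (SOME g. g \<in> hom C (Cod C f) (Dom C f) \<and>
     g \<cdot>\<^bsub>C\<^esub> f = Id C (Dom C f) \<and> f \<cdot>\<^bsub>C\<^esub> g = Id C (Cod C f))"

context category
begin

declare Dom_in_Obj [simp] Cod_in_Obj [simp]

lemma Id_arr [simp]:
  assumes "A \<in> Obj C"
  shows "Id C A \<in> Arr C" "Dom C (Id C A) = A" "Cod C (Id C A) = A"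
  using Id_in_hom[OF assms] by simp_all

lemma Comp_arr [simp]:
  assumes "f \<in> Arr C" "g \<in> Arr C" "Dom C g = Cod C f"
  shows "g \<cdot> f \<in> Arr C" "Dom C (g \<cdot> f) = Dom C f" "Cod C (g \<cdot> f) = Cod C g"
  using Comp_in_hom[of f "Dom C f" "Cod C f" g "Cod C g"] assms by simp_all

lemma Comp_Id_arr [simp]: "f \<in> Arr C \<Longrightarrow> A = Dom C f \<Longrightarrow> f \<cdot> Id C A = f"
  using Comp_Id[of f] by simp

lemma Id_Comp_arr [simp]: "f \<in> Arr C \<Longrightarrow> A = Cod C f \<Longrightarrow> Id C A \<cdot> f = f"
  using Id_Comp[of f] by simp

lemma Comp_assoc_arr [simp]:
  "f \<in> Arr C \<Longrightarrow> g \<in> Arr C \<Longrightarrow> h \<in> Arr C \<Longrightarrow> Dom C g = Cod C f \<Longrightarrow> Dom C h = Cod C g \<Longrightarrow>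
   (h \<cdot> g) \<cdot> f = h \<cdot> (g \<cdot> f)"
  using Comp_assoc[of f _ _ g _ h] by simp

text \<open>The form of an equation \<open>g \<cdot> f = h\<close> that rewrites inside a composite nested to the right.\<close>

lemma Comp_extend:
  "g \<cdot> f = h \<Longrightarrow> f \<in> Arr C \<Longrightarrow> g \<in> Arr C \<Longrightarrow> Dom C g = Cod C f \<Longrightarrow>
   x \<in> Arr C \<Longrightarrow> Cod C x = Dom C f \<Longrightarrow> g \<cdot> f \<cdot> x = h \<cdot> x"
  using Comp_assoc_arr[of x f g] by simp

lemma inv_arr:
  assumes "iso C A B f"
  shows "inv_arr C f \<in> Arr C" "Dom C (inv_arr C f) = B" "Cod C (inv_arr C f) = A"
    "inv_arr C f \<cdot> f = Id C A" "f \<cdot> inv_arr C f = Id C B"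
proof -
  have f: "f \<in> Arr C" "Dom C f = A" "Cod C f = B"
    using assms by (simp_all add: iso_def)
  obtain g where "g \<in> hom C B A" "g \<cdot> f = Id C A" "f \<cdot> g = Id C B"
    using assms unfolding iso_def by blast
  then have "g \<in> hom C (Cod C f) (Dom C f)" "g \<cdot> f = Id C (Dom C f)" "f \<cdot> g = Id C (Cod C f)"
    using f by simp_all
  then have "\<exists>g. g \<in> hom C (Cod C f) (Dom C f) \<and> g \<cdot> f = Id C (Dom C f) \<and> f \<cdot> g = Id C (Cod C f)"
    by blast
  note someI_ex[OF this, folded inv_arr_def]
  then show "inv_arr C f \<in> Arr C" "Dom C (inv_arr C f) = B" "Cod C (inv_arr C f) = A"
    "inv_arr C f \<cdot> f = Id C A" "f \<cdot> inv_arr C f = Id C B"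
    using f by simp_all
qed

lemma iso_left_cancel:
  assumes "iso C A B f" "f \<cdot> g = f \<cdot> h" "g \<in> hom C X A" "h \<in> hom C X A"
  shows "g = h"
proof -
  have f: "f \<in> Arr C" "Dom C f = A" "Cod C f = B"
    using assms(1) by (simp_all add: iso_def)
  have "inv_arr C f \<cdot> f \<cdot> g = inv_arr C f \<cdot> f \<cdot> h"
    by (simp add: assms(2))
  then show ?thesis
    using Comp_extend[OF inv_arr(4)[OF assms(1)]] inv_arr[OF assms(1)] assms(3,4) f
    by simp
qed

lemma iso_right_cancel:
  assumes "iso C A B f" "g \<cdot> f = h \<cdot> f" "g \<in> hom C B X" "h \<in> hom C B X"
  shows "g = h"
proof -
  have f: "f \<in> Arr C" "Dom C f = A" "Cod C f = B"
    using assms(1) by (simp_all add: iso_def)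
  have "(g \<cdot> f) \<cdot> inv_arr C f = (h \<cdot> f) \<cdot> inv_arr C f"
    by (simp add: assms(2))
  then show ?thesis
    using inv_arr[OF assms(1)] assms(3,4) f by simp
qed

lemma iso_Comp:
  assumes "iso C A B f" "iso C B D g"
  shows "iso C A D (g \<cdot> f)"
proof -
  have f: "f \<in> Arr C" "Dom C f = A" "Cod C f = B"
    using assms(1) by (simp_all add: iso_def)
  have g: "g \<in> Arr C" "Dom C g = B" "Cod C g = D"
    using assms(2) by (simp_all add: iso_def)
  show ?thesis
    unfolding iso_def
    using f g inv_arr[OF assms(1)] inv_arr[OF assms(2)]
      Comp_extend[OF inv_arr(4)[OF assms(2)]] Comp_extend[OF inv_arr(5)[OF assms(1)]]
    by (auto intro!: bexI[of _ "inv_arr C f \<cdot> inv_arr C g"])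
qed

end

section \<open>Units in a monoidal category\<close>

context symmetric_monoidal_category
begin

abbreviation e where "e \<equiv> unit C"

abbreviation assoc_inv where "assoc_inv A B D \<equiv> inv_arr C (assoc C A B D)"
abbreviation lunit_inv where "lunit_inv A \<equiv> inv_arr C (lunit C A)"

declare tens_in_Obj [simp] unit_in_Obj [simp] tens_Id [simp]

lemma tens_arr [simp]:
  assumes "f \<in> Arr C" "g \<in> Arr C"
  shows "f \<star> g \<in> Arr C" "Dom C (f \<star> g) = Dom C f \<otimes> Dom C g" "Cod C (f \<star> g) = Cod C f \<otimes> Cod C g"
  using tens_arr_in_hom[of f _ _ g] assms by simp_all

lemma interchange:
  "f \<in> Arr C \<Longrightarrow> g \<in> Arr C \<Longrightarrow> f' \<in> Arr C \<Longrightarrow> g' \<in> Arr C \<Longrightarrow>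
   Dom C g = Cod C f \<Longrightarrow> Dom C g' = Cod C f' \<Longrightarrow>
   (g \<star> g') \<cdot> (f \<star> f') = (g \<cdot> f) \<star> (g' \<cdot> f')"
  using tens_Comp[of f _ _ g _ f' _ _ g'] by simp

lemma interchange_extend:
  "f \<in> Arr C \<Longrightarrow> g \<in> Arr C \<Longrightarrow> f' \<in> Arr C \<Longrightarrow> g' \<in> Arr C \<Longrightarrow>
   Dom C g = Cod C f \<Longrightarrow> Dom C g' = Cod C f' \<Longrightarrow> x \<in> Arr C \<Longrightarrow> Cod C x = Dom C f \<otimes> Dom C f' \<Longrightarrow>
   (g \<star> g') \<cdot> (f \<star> f') \<cdot> x = ((g \<cdot> f) \<star> (g' \<cdot> f')) \<cdot> x"
  by (rule Comp_extend) (simp_all add: interchange)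

lemma assoc_arr [simp]:
  assumes "A \<in> Obj C" "B \<in> Obj C" "D \<in> Obj C"
  shows "assoc C A B D \<in> Arr C" "Dom C (assoc C A B D) = (A \<otimes> B) \<otimes> D"
    "Cod C (assoc C A B D) = A \<otimes> B \<otimes> D"
    "assoc_inv A B D \<in> Arr C" "Dom C (assoc_inv A B D) = A \<otimes> B \<otimes> D"
    "Cod C (assoc_inv A B D) = (A \<otimes> B) \<otimes> D"
    "assoc_inv A B D \<cdot> assoc C A B D = Id C ((A \<otimes> B) \<otimes> D)"
    "assoc C A B D \<cdot> assoc_inv A B D = Id C (A \<otimes> B \<otimes> D)"
  using assoc_iso[OF assms] inv_arr[OF assoc_iso[OF assms]] by (simp_all add: iso_def)

lemma lunit_arr [simp]:
  assumes "A \<in> Obj C"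
  shows "lunit C A \<in> Arr C" "Dom C (lunit C A) = e \<otimes> A" "Cod C (lunit C A) = A"
    "lunit_inv A \<in> Arr C" "Dom C (lunit_inv A) = A" "Cod C (lunit_inv A) = e \<otimes> A"
    "lunit_inv A \<cdot> lunit C A = Id C (e \<otimes> A)"
    "lunit C A \<cdot> lunit_inv A = Id C A"
  using lunit_iso[OF assms] inv_arr[OF lunit_iso[OF assms]] by (simp_all add: iso_def)

lemma runit_arr [simp]:
  assumes "A \<in> Obj C"
  shows "runit C A \<in> Arr C" "Dom C (runit C A) = A \<otimes> e" "Cod C (runit C A) = A"
  using runit_iso[OF assms] by (simp_all add: iso_def)

lemma braid_arr [simp]:
  assumes "A \<in> Obj C" "B \<in> Obj C"
  shows "braid C A B \<in> Arr C" "Dom C (braid C A B) = A \<otimes> B" "Cod C (braid C A B) = B \<otimes> A"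
  using braid_in_hom[OF assms] by simp_all

lemma cancel_extend [simp]:
  assumes "A \<in> Obj C" "x \<in> Arr C"
  shows "B \<in> Obj C \<Longrightarrow> D \<in> Obj C \<Longrightarrow> Cod C x = (A \<otimes> B) \<otimes> D \<Longrightarrow>
      assoc_inv A B D \<cdot> assoc C A B D \<cdot> x = x"
    "B \<in> Obj C \<Longrightarrow> D \<in> Obj C \<Longrightarrow> Cod C x = A \<otimes> B \<otimes> D \<Longrightarrow>
      assoc C A B D \<cdot> assoc_inv A B D \<cdot> x = x"
    "Cod C x = e \<otimes> A \<Longrightarrow> lunit_inv A \<cdot> lunit C A \<cdot> x = x"
    "Cod C x = A \<Longrightarrow> lunit C A \<cdot> lunit_inv A \<cdot> x = x"
    "B \<in> Obj C \<Longrightarrow> Cod C x = A \<otimes> B \<Longrightarrow> braid C B A \<cdot> braid C A B \<cdot> x = x"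
  using assms
  by (simp_all add: Comp_extend[OF assoc_arr(7)] Comp_extend[OF assoc_arr(8)]
      Comp_extend[OF lunit_arr(7)] Comp_extend[OF lunit_arr(8)] Comp_extend[OF braid_symmetric])

lemma unit_tens_faithful:
  assumes "Id C e \<star> f = Id C e \<star> g" "f \<in> hom C A B" "g \<in> hom C A B"
  shows "f = g"
proof (rule iso_right_cancel[OF lunit_iso[of A]])
  show "A \<in> Obj C" using assms by auto
  show "f \<cdot> lunit C A = g \<cdot> lunit C A"
    using lunit_natural[OF assms(2)] lunit_natural[OF assms(3)] assms(1) by simp
qed (use assms in auto)

lemma tens_unit_faithful:
  assumes "f \<star> Id C e = g \<star> Id C e" "f \<in> hom C A B" "g \<in> hom C A B"
  shows "f = g"
proof (rule iso_right_cancel[OF runit_iso[of A]])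
  show "A \<in> Obj C" using assms by auto
  show "f \<cdot> runit C A = g \<cdot> runit C A"
    using runit_natural[OF assms(2)] runit_natural[OF assms(3)] assms(1) by simp
qed (use assms in auto)

lemma iso_tens:
  assumes "iso C A A' f" "iso C B B' g"
  shows "iso C (A \<otimes> B) (A' \<otimes> B') (f \<star> g)"
proof -
  have f: "f \<in> Arr C" "Dom C f = A" "Cod C f = A'" "A \<in> Obj C" "A' \<in> Obj C"
    using assms(1) by (auto simp: iso_def)
  have g: "g \<in> Arr C" "Dom C g = B" "Cod C g = B'" "B \<in> Obj C" "B' \<in> Obj C"
    using assms(2) by (auto simp: iso_def)
  show ?thesis
    unfolding iso_def using f g inv_arr[OF assms(1)] inv_arr[OF assms(2)]
    by (auto intro!: bexI[of _ "inv_arr C f \<star> inv_arr C g"] simp: interchange)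
qed

lemma iso_Id: "A \<in> Obj C \<Longrightarrow> iso C A A (Id C A)"
  by (auto simp: iso_def intro!: bexI[of _ "Id C A"])

text \<open>This coherence and the next one are not axioms, but follow from pentagon and triangle: since tensoring
  with the unit object is faithful, it suffices to prove them tensored with it, and then each is read off
  from a pentagon, two of whose associators are absorbed by triangles.\<close>

lemma runit_tens:
  assumes [simp]: "A \<in> Obj C" "B \<in> Obj C"
  shows "(Id C A \<star> runit C B) \<cdot> assoc C A B e = runit C (A \<otimes> B)"
proof (rule tens_unit_faithful)
  let ?l = "lunit C e"
  have "assoc C A B e \<cdot> (((Id C A \<star> runit C B) \<cdot> assoc C A B e) \<star> Id C e)
    = (assoc C A B e \<cdot> ((Id C A \<star> runit C B) \<star> Id C e)) \<cdot> (assoc C A B e \<star> Id C e)"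
    by (simp add: interchange)
  also have "\<dots> = ((Id C A \<star> (runit C B \<star> Id C e)) \<cdot> assoc C A (B \<otimes> e) e) \<cdot> (assoc C A B e \<star> Id C e)"
    by (subst assoc_natural) auto
  also have "\<dots> = (Id C A \<star> (Id C B \<star> ?l)) \<cdot>
      ((Id C A \<star> assoc C B e e) \<cdot> assoc C A (B \<otimes> e) e \<cdot> (assoc C A B e \<star> Id C e))"
    by (simp add: triangle[symmetric] interchange_extend)
  also have "\<dots> = (Id C A \<star> (Id C B \<star> ?l)) \<cdot> assoc C A B (e \<otimes> e) \<cdot> assoc C (A \<otimes> B) e e"
    by (simp add: pentagon)
  also have "\<dots> = (assoc C A B e \<cdot> ((Id C A \<star> Id C B) \<star> ?l)) \<cdot> assoc C (A \<otimes> B) e e"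
    by (subst assoc_natural) auto
  also have "\<dots> = assoc C A B e \<cdot> (runit C (A \<otimes> B) \<star> Id C e)"
    by (simp add: triangle)
  finally have *: "assoc C A B e \<cdot> (((Id C A \<star> runit C B) \<cdot> assoc C A B e) \<star> Id C e)
    = assoc C A B e \<cdot> (runit C (A \<otimes> B) \<star> Id C e)" .
  show "((Id C A \<star> runit C B) \<cdot> assoc C A B e) \<star> Id C e = runit C (A \<otimes> B) \<star> Id C e"
    by (rule iso_left_cancel[OF assoc_iso *]) auto
qed auto

lemma lunit_tens:
  assumes [simp]: "A \<in> Obj C" "B \<in> Obj C"
  shows "lunit C (A \<otimes> B) \<cdot> assoc C e A B = lunit C A \<star> Id C B"
proof (rule unit_tens_faithful)
  let ?k = "assoc C e (e \<otimes> A) B \<cdot> (assoc C e e A \<star> Id C B)"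
  have k: "iso C (((e \<otimes> e) \<otimes> A) \<otimes> B) (e \<otimes> ((e \<otimes> A) \<otimes> B)) ?k"
    by (rule iso_Comp[OF iso_tens[OF assoc_iso iso_Id] assoc_iso]) auto
  have "(Id C e \<star> (lunit C (A \<otimes> B) \<cdot> assoc C e A B)) \<cdot> ?k
    = (Id C e \<star> lunit C (A \<otimes> B)) \<cdot>
      ((Id C e \<star> assoc C e A B) \<cdot> assoc C e (e \<otimes> A) B \<cdot> (assoc C e e A \<star> Id C B))"
    by (simp add: interchange_extend)
  also have "\<dots> = ((Id C e \<star> lunit C (A \<otimes> B)) \<cdot> assoc C e e (A \<otimes> B)) \<cdot> assoc C (e \<otimes> e) A B"
    by (simp add: pentagon)
  also have "\<dots> = (runit C e \<star> (Id C A \<star> Id C B)) \<cdot> assoc C (e \<otimes> e) A B"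
    by (subst triangle) auto
  also have "\<dots> = assoc C e A B \<cdot> ((runit C e \<star> Id C A) \<star> Id C B)"
    by (subst assoc_natural) auto
  also have "\<dots> = (assoc C e A B \<cdot> ((Id C e \<star> lunit C A) \<star> Id C B)) \<cdot> (assoc C e e A \<star> Id C B)"
    by (simp add: triangle[symmetric] interchange)
  also have "\<dots> = ((Id C e \<star> (lunit C A \<star> Id C B)) \<cdot> assoc C e (e \<otimes> A) B) \<cdot> (assoc C e e A \<star> Id C B)"
    by (subst assoc_natural) auto
  also have "\<dots> = (Id C e \<star> (lunit C A \<star> Id C B)) \<cdot> ?k"
    by simp
  finally show "Id C e \<star> (lunit C (A \<otimes> B) \<cdot> assoc C e A B) = Id C e \<star> (lunit C A \<star> Id C B)"
    by (rule iso_right_cancel[OF k]) auto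
qed auto

lemma lunit_unit: "lunit C e = runit C e"
proof (rule tens_unit_faithful)
  have "lunit C e \<cdot> (Id C e \<star> lunit C e) = lunit C e \<cdot> lunit C (e \<otimes> e)"
    by (rule lunit_natural) auto
  then have "Id C e \<star> lunit C e = lunit C (e \<otimes> e)"
    by (rule iso_left_cancel[OF lunit_iso, rotated]) auto
  then show "lunit C e \<star> Id C e = runit C e \<star> Id C e"
    using lunit_tens[of e e] triangle[of e e] by simp
qed auto

end

section \<open>Trace-class morphisms\<close>

context symmetric_monoidal_category
begin

lemma assoc_inv_natural:
  assumes [simp]: "f \<in> Arr C" "g \<in> Arr C" "h \<in> Arr C"
  shows "assoc_inv (Cod C f) (Cod C g) (Cod C h) \<cdot> (f \<star> (g \<star> h)) =
    ((f \<star> g) \<star> h) \<cdot> assoc_inv (Dom C f) (Dom C g) (Dom C h)"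
proof -
  have "assoc_inv (Cod C f) (Cod C g) (Cod C h) \<cdot> (f \<star> (g \<star> h)) =
    assoc_inv (Cod C f) (Cod C g) (Cod C h) \<cdot>
      ((f \<star> (g \<star> h)) \<cdot> assoc C (Dom C f) (Dom C g) (Dom C h)) \<cdot> assoc_inv (Dom C f) (Dom C g) (Dom C h)"
    by simp
  also have "\<dots> = assoc_inv (Cod C f) (Cod C g) (Cod C h) \<cdot>
      (assoc C (Cod C f) (Cod C g) (Cod C h) \<cdot> ((f \<star> g) \<star> h)) \<cdot> assoc_inv (Dom C f) (Dom C g) (Dom C h)"
    by (subst assoc_natural[of f _ _ g _ _ h]) auto
  finally show ?thesis by simp
qed

lemma lunit_inv_natural:
  assumes [simp]: "f \<in> Arr C"
  shows "lunit_inv (Cod C f) \<cdot> f = (Id C e \<star> f) \<cdot> lunit_inv (Dom C f)"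
proof -
  have "lunit_inv (Cod C f) \<cdot> f =
      lunit_inv (Cod C f) \<cdot> (f \<cdot> lunit C (Dom C f)) \<cdot> lunit_inv (Dom C f)"
    by simp
  also have "\<dots> = lunit_inv (Cod C f) \<cdot> (lunit C (Cod C f) \<cdot> (Id C e \<star> f)) \<cdot> lunit_inv (Dom C f)"
    by (subst lunit_natural[of f]) auto
  finally show ?thesis by simp
qed

lemma assoc_lunit_inv_tens:
  assumes [simp]: "A \<in> Obj C" "B \<in> Obj C"
  shows "assoc C e A B \<cdot> (lunit_inv A \<star> Id C B) = lunit_inv (A \<otimes> B)"
proof -
  have "assoc C e A B \<cdot> (lunit_inv A \<star> Id C B) =
    lunit_inv (A \<otimes> B) \<cdot> (lunit C (A \<otimes> B) \<cdot> assoc C e A B) \<cdot> (lunit_inv A \<star> Id C B)"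
    by simp
  also have "\<dots> = lunit_inv (A \<otimes> B)"
    by (subst lunit_tens) (auto simp: interchange)
  finally show ?thesis .
qed

lemma assoc_inv_pentagon:
  assumes [simp]: "A \<in> Obj C" "B \<in> Obj C" "D \<in> Obj C" "E \<in> Obj C"
  shows "assoc_inv A B (D \<otimes> E) \<cdot> (Id C A \<star> assoc C B D E) \<cdot> assoc C A (B \<otimes> D) E =
    assoc C (A \<otimes> B) D E \<cdot> (assoc_inv A B D \<star> Id C E)"
proof -
  have "assoc_inv A B (D \<otimes> E) \<cdot> (Id C A \<star> assoc C B D E) \<cdot> assoc C A (B \<otimes> D) E =
    assoc_inv A B (D \<otimes> E) \<cdot> ((Id C A \<star> assoc C B D E) \<cdot> assoc C A (B \<otimes> D) E \<cdot>
      (assoc C A B D \<star> Id C E)) \<cdot> (assoc_inv A B D \<star> Id C E)"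
    by (simp add: interchange)
  also have "\<dots> = assoc_inv A B (D \<otimes> E) \<cdot> (assoc C A B (D \<otimes> E) \<cdot> assoc C (A \<otimes> B) D E) \<cdot>
     (assoc_inv A B D \<star> Id C E)"
    by (subst pentagon) auto
  finally show ?thesis by simp
qed

text \<open>A morphism \<open>t : e \<rightarrow> X \<otimes> D\<close> turns \<open>p : D \<otimes> Z \<rightarrow> P\<close> into
  \<open>Z \<cong> e \<otimes> Z \<rightarrow> (X \<otimes> D) \<otimes> Z \<cong> X \<otimes> (D \<otimes> Z) \<rightarrow> X \<otimes> P\<close>.\<close>

definition transpose where
  "transpose X D t Z p = (Id C X \<star> p) \<cdot> assoc C X D Z \<cdot> (t \<star> Id C Z) \<cdot> lunit_inv Z"

text \<open>A morphism \<open>X \<rightarrow> X'\<close> is trace class if it arises from some \<open>t : e \<rightarrow> X' \<otimes> D\<close> and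
  \<open>\<epsilon> : D \<otimes> X \<rightarrow> e\<close>. In a closed category \<open>D\<close> can be taken to be the dual of \<open>X\<close> and \<open>\<epsilon>\<close> evaluation;
  leaving both arbitrary saves computing the dual of a tensor product.\<close>

definition trace_class where
  "trace_class X X' u \<longleftrightarrow> (\<exists>D \<in> Obj C. \<exists>t \<in> hom C e (X' \<otimes> D). \<exists>\<epsilon> \<in> hom C (D \<otimes> X) e.
     u = runit C X' \<cdot> transpose X' D t X \<epsilon>)"

context
  fixes X D t
  assumes t [simp]: "X \<in> Obj C" "D \<in> Obj C" "t \<in> Arr C" "Dom C t = e" "Cod C t = X \<otimes> D"
begin

lemma transpose_arr [simp]:
  assumes "p \<in> Arr C" "Z \<in> Obj C" "Dom C p = D \<otimes> Z"
  shows "transpose X D t Z p \<in> Arr C" "Dom C (transpose X D t Z p) = Z"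
    "Cod C (transpose X D t Z p) = X \<otimes> Cod C p"
  using assms by (simp_all add: transpose_def)

lemma transpose_Comp_left:
  assumes [simp]: "p \<in> Arr C" "Z \<in> Obj C" "Dom C p = D \<otimes> Z" "q \<in> Arr C" "Dom C q = Cod C p"
  shows "(Id C X \<star> q) \<cdot> transpose X D t Z p = transpose X D t Z (q \<cdot> p)"
  by (simp add: transpose_def interchange_extend)

lemma transpose_Comp_right:
  assumes [simp]: "p \<in> Arr C" "Dom C p = D \<otimes> Cod C h" "h \<in> Arr C"
  shows "transpose X D t (Cod C h) p \<cdot> h = transpose X D t (Dom C h) (p \<cdot> (Id C D \<star> h))"
proof -
  have "transpose X D t (Cod C h) p \<cdot> h =
    (Id C X \<star> p) \<cdot> assoc C X D (Cod C h) \<cdot> (t \<star> Id C (Cod C h)) \<cdot> (lunit_inv (Cod C h) \<cdot> h)"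
    by (simp add: transpose_def)
  also have "\<dots> = (Id C X \<star> p) \<cdot> (assoc C X D (Cod C h) \<cdot> ((Id C X \<star> Id C D) \<star> h)) \<cdot>
      (t \<star> Id C (Dom C h)) \<cdot> lunit_inv (Dom C h)"
    by (subst lunit_inv_natural) (simp_all add: interchange_extend)
  also have "\<dots> = (Id C X \<star> p) \<cdot> ((Id C X \<star> (Id C D \<star> h)) \<cdot> assoc C X D (Dom C h)) \<cdot>
      (t \<star> Id C (Dom C h)) \<cdot> lunit_inv (Dom C h)"
    by (subst assoc_natural) auto
  also have "\<dots> = transpose X D t (Dom C h) (p \<cdot> (Id C D \<star> h))"
    by (simp add: transpose_def interchange_extend)
  finally show ?thesis .
qed

lemma assoc_transpose:
  assumes [simp]: "p \<in> Arr C" "Z \<in> Obj C" "Dom C p = D \<otimes> Z" "W \<in> Obj C"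
  shows "assoc C X (Cod C p) W \<cdot> (transpose X D t Z p \<star> Id C W) =
    transpose X D t (Z \<otimes> W) ((p \<star> Id C W) \<cdot> assoc_inv D Z W)"
proof -
  have "transpose X D t Z p \<star> Id C W =
    ((Id C X \<star> p) \<star> Id C W) \<cdot> (assoc C X D Z \<star> Id C W) \<cdot>
      ((t \<star> Id C Z) \<star> Id C W) \<cdot> (lunit_inv Z \<star> Id C W)"
    by (simp add: transpose_def interchange)
  then have "assoc C X (Cod C p) W \<cdot> (transpose X D t Z p \<star> Id C W) =
    (assoc C X (Cod C p) W \<cdot> ((Id C X \<star> p) \<star> Id C W)) \<cdot> (assoc C X D Z \<star> Id C W) \<cdot>
      ((t \<star> Id C Z) \<star> Id C W) \<cdot> (lunit_inv Z \<star> Id C W)"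
    by simp
  also have "\<dots> = ((Id C X \<star> (p \<star> Id C W)) \<cdot> assoc C X (D \<otimes> Z) W) \<cdot> (assoc C X D Z \<star> Id C W) \<cdot>
      ((t \<star> Id C Z) \<star> Id C W) \<cdot> (lunit_inv Z \<star> Id C W)"
    by (subst assoc_natural) auto
  also have "\<dots> = (Id C X \<star> ((p \<star> Id C W) \<cdot> assoc_inv D Z W)) \<cdot>
      ((Id C X \<star> assoc C D Z W) \<cdot> assoc C X (D \<otimes> Z) W \<cdot> (assoc C X D Z \<star> Id C W)) \<cdot>
      ((t \<star> Id C Z) \<star> Id C W) \<cdot> (lunit_inv Z \<star> Id C W)"
    by (simp add: interchange_extend)
  also have "\<dots> = (Id C X \<star> ((p \<star> Id C W) \<cdot> assoc_inv D Z W)) \<cdot>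
      (assoc C X D (Z \<otimes> W) \<cdot> assoc C (X \<otimes> D) Z W) \<cdot>
      ((t \<star> Id C Z) \<star> Id C W) \<cdot> (lunit_inv Z \<star> Id C W)"
    by (subst pentagon) auto
  also have "\<dots> = (Id C X \<star> ((p \<star> Id C W) \<cdot> assoc_inv D Z W)) \<cdot> assoc C X D (Z \<otimes> W) \<cdot>
      (assoc C (X \<otimes> D) Z W \<cdot> ((t \<star> Id C Z) \<star> Id C W)) \<cdot> (lunit_inv Z \<star> Id C W)"
    by simp
  also have "\<dots> = (Id C X \<star> ((p \<star> Id C W) \<cdot> assoc_inv D Z W)) \<cdot> assoc C X D (Z \<otimes> W) \<cdot>
      ((t \<star> (Id C Z \<star> Id C W)) \<cdot> assoc C e Z W) \<cdot> (lunit_inv Z \<star> Id C W)"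
    by (subst assoc_natural) auto
  also have "\<dots> = transpose X D t (Z \<otimes> W) ((p \<star> Id C W) \<cdot> assoc_inv D Z W)"
    by (simp add: transpose_def assoc_lunit_inv_tens)
  finally show ?thesis .
qed

text \<open>If \<open>t\<close> and \<open>\<epsilon> : D \<otimes> Z \<rightarrow> e\<close> exhibit \<open>u : Z \<rightarrow> X\<close> as trace class, then the transpose of the contraction
  \<open>D \<otimes> (Z \<otimes> W) \<rightarrow> W\<close> along \<open>\<epsilon>\<close> is \<open>u \<otimes> W\<close>.\<close>

lemma transpose_contraction:
  assumes [simp]: "\<epsilon> \<in> Arr C" "Z \<in> Obj C" "Dom C \<epsilon> = D \<otimes> Z" "Cod C \<epsilon> = e" "W \<in> Obj C"
  shows "transpose X D t (Z \<otimes> W) (lunit C W \<cdot> (\<epsilon> \<star> Id C W) \<cdot> assoc_inv D Z W) =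
    (runit C X \<cdot> transpose X D t Z \<epsilon>) \<star> Id C W"
proof -
  have "transpose X D t (Z \<otimes> W) (lunit C W \<cdot> (\<epsilon> \<star> Id C W) \<cdot> assoc_inv D Z W) =
    (Id C X \<star> lunit C W) \<cdot> transpose X D t (Z \<otimes> W) ((\<epsilon> \<star> Id C W) \<cdot> assoc_inv D Z W)"
    by (simp add: transpose_Comp_left)
  also have "\<dots> = (Id C X \<star> lunit C W) \<cdot> assoc C X e W \<cdot> (transpose X D t Z \<epsilon> \<star> Id C W)"
    using assoc_transpose[of \<epsilon> Z W] by simp
  also have "\<dots> = ((Id C X \<star> lunit C W) \<cdot> assoc C X e W) \<cdot> (transpose X D t Z \<epsilon> \<star> Id C W)"
    by simp
  also have "\<dots> = (runit C X \<star> Id C W) \<cdot> (transpose X D t Z \<epsilon> \<star> Id C W)"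
    by (simp add: triangle)
  also have "\<dots> = (runit C X \<cdot> transpose X D t Z \<epsilon>) \<star> Id C W"
    by (simp add: interchange)
  finally show ?thesis .
qed

end

text \<open>Transposing along \<open>t'\<close> and then along \<open>t\<close> is transposing along the nested composite
  \<open>e \<rightarrow> X \<otimes> D \<rightarrow> X \<otimes> (Y \<otimes> (E \<otimes> D))\<close>.\<close>

lemma transpose_transpose:
  fixes X D t Y E t'
  assumes [simp]: "X \<in> Obj C" "D \<in> Obj C" "Y \<in> Obj C" "E \<in> Obj C" "Z \<in> Obj C"
    and [simp]: "t \<in> Arr C" "Dom C t = e" "Cod C t = X \<otimes> D"
    and [simp]: "t' \<in> Arr C" "Dom C t' = e" "Cod C t' = Y \<otimes> E"
    and [simp]: "p \<in> Arr C" "Dom C p = (E \<otimes> D) \<otimes> Z"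
  defines "s \<equiv> assoc_inv X Y (E \<otimes> D) \<cdot> (Id C X \<star> transpose Y E t' D (Id C (E \<otimes> D))) \<cdot> t"
  shows "transpose (X \<otimes> Y) (E \<otimes> D) s Z p =
    assoc_inv X Y (Cod C p) \<cdot> transpose X D t Z (transpose Y E t' (D \<otimes> Z) (p \<cdot> assoc_inv E D Z))"
proof -
  let ?c = "transpose Y E t' D (Id C (E \<otimes> D))"
  let ?r = "assoc C X D Z \<cdot> (t \<star> Id C Z) \<cdot> lunit_inv Z"
  have "transpose Y E t' (D \<otimes> Z) (p \<cdot> assoc_inv E D Z) =
    (Id C Y \<star> p) \<cdot> transpose Y E t' (D \<otimes> Z) ((Id C (E \<otimes> D) \<star> Id C Z) \<cdot> assoc_inv E D Z)"
    by (subst transpose_Comp_left) auto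
  also have "\<dots> = (Id C Y \<star> p) \<cdot> assoc C Y (E \<otimes> D) Z \<cdot> (?c \<star> Id C Z)"
    using assoc_transpose[of Y E t' "Id C (E \<otimes> D)" D Z] by simp
  finally have "assoc_inv X Y (Cod C p) \<cdot>
      transpose X D t Z (transpose Y E t' (D \<otimes> Z) (p \<cdot> assoc_inv E D Z)) =
    (assoc_inv X Y (Cod C p) \<cdot> (Id C X \<star> (Id C Y \<star> p))) \<cdot> (Id C X \<star> assoc C Y (E \<otimes> D) Z) \<cdot>
      (Id C X \<star> (?c \<star> Id C Z)) \<cdot> ?r"
    by (simp add: transpose_def[of X] interchange_extend)
  also have "\<dots> = (((Id C X \<star> Id C Y) \<star> p) \<cdot> assoc_inv X Y ((E \<otimes> D) \<otimes> Z)) \<cdot>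
      (Id C X \<star> assoc C Y (E \<otimes> D) Z) \<cdot> (Id C X \<star> (?c \<star> Id C Z)) \<cdot> ?r"
    using assoc_inv_natural[of "Id C X" "Id C Y" p] by simp
  also have "\<dots> = (Id C (X \<otimes> Y) \<star> p) \<cdot> assoc_inv X Y ((E \<otimes> D) \<otimes> Z) \<cdot>
      (Id C X \<star> assoc C Y (E \<otimes> D) Z) \<cdot> ((Id C X \<star> (?c \<star> Id C Z)) \<cdot> assoc C X D Z) \<cdot>
      (t \<star> Id C Z) \<cdot> lunit_inv Z"
    by simp
  also have "\<dots> = (Id C (X \<otimes> Y) \<star> p) \<cdot> assoc_inv X Y ((E \<otimes> D) \<otimes> Z) \<cdot>
      (Id C X \<star> assoc C Y (E \<otimes> D) Z) \<cdot>
      (assoc C X (Y \<otimes> E \<otimes> D) Z \<cdot> ((Id C X \<star> ?c) \<star> Id C Z)) \<cdot> (t \<star> Id C Z) \<cdot> lunit_inv Z"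
    by (subst assoc_natural[of "Id C X" _ _ ?c _ _ "Id C Z"]) auto
  also have "\<dots> = (Id C (X \<otimes> Y) \<star> p) \<cdot> (assoc_inv X Y ((E \<otimes> D) \<otimes> Z) \<cdot>
      (Id C X \<star> assoc C Y (E \<otimes> D) Z) \<cdot> assoc C X (Y \<otimes> E \<otimes> D) Z) \<cdot>
      ((Id C X \<star> ?c) \<star> Id C Z) \<cdot> (t \<star> Id C Z) \<cdot> lunit_inv Z"
    by simp
  also have "\<dots> = (Id C (X \<otimes> Y) \<star> p) \<cdot>
      (assoc C (X \<otimes> Y) (E \<otimes> D) Z \<cdot> (assoc_inv X Y (E \<otimes> D) \<star> Id C Z)) \<cdot>
      ((Id C X \<star> ?c) \<star> Id C Z) \<cdot> (t \<star> Id C Z) \<cdot> lunit_inv Z"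
    by (subst assoc_inv_pentagon) auto
  also have "\<dots> = transpose (X \<otimes> Y) (E \<otimes> D) s Z p"
    by (simp add: transpose_def[of "X \<otimes> Y"] s_def interchange interchange_extend)
  finally show ?thesis ..
qed

text \<open>The pairing \<open>\<delta> : (E \<otimes> D) \<otimes> (X \<otimes> Y) \<rightarrow> e\<close> first contracts the inner factors \<open>D \<otimes> X\<close> by \<open>\<epsilon>\<close> and then
  \<open>E \<otimes> Y\<close> by \<open>\<epsilon>'\<close>.\<close>

lemma trace_class_tens:
  assumes u: "trace_class X X' u" and v: "trace_class Y Y' v"
    and [simp]: "X \<in> Obj C" "X' \<in> Obj C" "Y \<in> Obj C" "Y' \<in> Obj C"
  shows "trace_class (X \<otimes> Y) (X' \<otimes> Y') (u \<star> v)"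
proof -
  obtain D t \<epsilon> where [simp]: "D \<in> Obj C" and t: "t \<in> hom C e (X' \<otimes> D)"
    and \<epsilon>: "\<epsilon> \<in> hom C (D \<otimes> X) e" and u_eq: "u = runit C X' \<cdot> transpose X' D t X \<epsilon>"
    using u unfolding trace_class_def by blast
  obtain E t' \<epsilon>' where [simp]: "E \<in> Obj C" and t': "t' \<in> hom C e (Y' \<otimes> E)"
    and \<epsilon>': "\<epsilon>' \<in> hom C (E \<otimes> Y) e" and v_eq: "v = runit C Y' \<cdot> transpose Y' E t' Y \<epsilon>'"
    using v unfolding trace_class_def by blast
  have [simp]: "t \<in> Arr C" "Dom C t = e" "Cod C t = X' \<otimes> D"
    "t' \<in> Arr C" "Dom C t' = e" "Cod C t' = Y' \<otimes> E"
    using t t' by simp_all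
  have [simp]: "\<epsilon> \<in> Arr C" "Dom C \<epsilon> = D \<otimes> X" "Cod C \<epsilon> = e"
    "\<epsilon>' \<in> Arr C" "Dom C \<epsilon>' = E \<otimes> Y" "Cod C \<epsilon>' = e"
    using \<epsilon> \<epsilon>' by simp_all
  let ?Phi = "transpose X' D t" and ?Phi' = "transpose Y' E t'"
  define s where "s = assoc_inv X' Y' (E \<otimes> D) \<cdot> (Id C X' \<star> ?Phi' D (Id C (E \<otimes> D))) \<cdot> t"
  define k where "k = lunit C Y \<cdot> (\<epsilon> \<star> Id C Y) \<cdot> assoc_inv D X Y"
  define \<delta> where "\<delta> = \<epsilon>' \<cdot> (Id C E \<star> k) \<cdot> assoc C E D (X \<otimes> Y)"
  have [simp]: "k \<in> Arr C" "Dom C k = D \<otimes> X \<otimes> Y" "Cod C k = Y"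
    by (simp_all add: k_def)
  have [simp]: "\<delta> \<in> Arr C" "Dom C \<delta> = (E \<otimes> D) \<otimes> X \<otimes> Y" "Cod C \<delta> = e"
    by (simp_all add: \<delta>_def)
  have "transpose (X' \<otimes> Y') (E \<otimes> D) s (X \<otimes> Y) \<delta> =
    assoc_inv X' Y' e \<cdot> ?Phi (X \<otimes> Y) (?Phi' (D \<otimes> X \<otimes> Y) (\<delta> \<cdot> assoc_inv E D (X \<otimes> Y)))"
    unfolding s_def by (subst transpose_transpose) auto
  also have "\<delta> \<cdot> assoc_inv E D (X \<otimes> Y) = \<epsilon>' \<cdot> (Id C E \<star> k)"
    by (simp add: \<delta>_def)
  also have "?Phi' (D \<otimes> X \<otimes> Y) \<dots> = ?Phi' Y \<epsilon>' \<cdot> k"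
    using transpose_Comp_right[of Y' E t' \<epsilon>' k] by simp
  also have "?Phi (X \<otimes> Y) \<dots> = (Id C X' \<star> ?Phi' Y \<epsilon>') \<cdot> ?Phi (X \<otimes> Y) k"
    by (subst transpose_Comp_left) auto
  also have "?Phi (X \<otimes> Y) k = u \<star> Id C Y"
    unfolding k_def u_eq by (rule transpose_contraction) auto
  finally have "runit C (X' \<otimes> Y') \<cdot> transpose (X' \<otimes> Y') (E \<otimes> D) s (X \<otimes> Y) \<delta> =
    runit C (X' \<otimes> Y') \<cdot> assoc_inv X' Y' e \<cdot> (Id C X' \<star> ?Phi' Y \<epsilon>') \<cdot> (u \<star> Id C Y)"
    by simp
  also have "\<dots> = (Id C X' \<star> runit C Y') \<cdot> (Id C X' \<star> ?Phi' Y \<epsilon>') \<cdot> (u \<star> Id C Y)"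
    by (subst runit_tens[symmetric]) (auto simp: u_eq)
  also have "\<dots> = u \<star> v"
    by (simp add: interchange u_eq v_eq)
  finally have "u \<star> v = runit C (X' \<otimes> Y') \<cdot> transpose (X' \<otimes> Y') (E \<otimes> D) s (X \<otimes> Y) \<delta>" ..
  moreover have "s \<in> hom C e ((X' \<otimes> Y') \<otimes> (E \<otimes> D))"
    by (simp add: s_def)
  moreover have "\<delta> \<in> hom C ((E \<otimes> D) \<otimes> (X \<otimes> Y)) e"
    by simp
  ultimately show ?thesis
    unfolding trace_class_def by (intro bexI[of _ "E \<otimes> D"] bexI[of _ s] bexI[of _ \<delta>]) auto
qed

end

section \<open>Trace-class morphisms and internal Homs\<close>

context closed_symmetric_monoidal_category
begin

declare ihom_in_Obj [simp]

lemma eval_arr [simp]: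
  assumes "A \<in> Obj C" "B \<in> Obj C"
  shows "eval C A B \<in> Arr C" "Dom C (eval C A B) = ihom C A B \<otimes> A" "Cod C (eval C A B) = B"
  using eval_in_hom[OF assms] by simp_all

lemma dual_in_Obj [simp]: "W \<in> Obj C \<Longrightarrow> dual C W \<in> Obj C"
  by (simp add: dual_def)

lemma ihom_unit [simp]: "ihom C W e = dual C W"
  by (simp add: dual_def)

lemma curry_arr [simp]:
  assumes "f \<in> Arr C" "Z \<in> Obj C" "A \<in> Obj C" "Dom C f = Z \<otimes> A" "B = Cod C f"
  shows "curry C Z A B f \<in> Arr C" "Dom C (curry C Z A B f) = Z" "Cod C (curry C Z A B f) = ihom C A B"
    "eval C A B \<cdot> (curry C Z A B f \<star> Id C A) = f"
proof -
  have "\<exists>!g. g \<in> hom C Z (ihom C A B) \<and> eval C A B \<cdot> (g \<star> Id C A) = f"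
    using assms by (intro eval_universal) auto
  from theI'[OF this, folded curry_def]
  show "curry C Z A B f \<in> Arr C" "Dom C (curry C Z A B f) = Z" "Cod C (curry C Z A B f) = ihom C A B"
    "eval C A B \<cdot> (curry C Z A B f \<star> Id C A) = f"
    by simp_all
qed

lemma uncurry_inject:
  assumes "eval C A B \<cdot> (g \<star> Id C A) = eval C A B \<cdot> (h \<star> Id C A)"
    "g \<in> hom C Z (ihom C A B)" "h \<in> hom C Z (ihom C A B)" "A \<in> Obj C" "B \<in> Obj C"
  shows "g = h"
proof -
  have Z: "Z \<in> Obj C"
    using assms(2) by auto
  have "eval C A B \<cdot> (h \<star> Id C A) \<in> hom C (Z \<otimes> A) B"
    using assms(3-5) by simp
  from eval_universal[OF Z assms(4,5) this] show ?thesis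
    using assms(1-3) by blast
qed

lemma ihom_arr_arr [simp]:
  assumes "f \<in> Arr C" "W \<in> Obj C"
  shows "ihom_arr C W f \<in> Arr C" "Dom C (ihom_arr C W f) = ihom C W (Dom C f)"
    "Cod C (ihom_arr C W f) = ihom C W (Cod C f)"
  using assms by (simp_all add: ihom_arr_def)

lemma eval_ihom_arr:
  assumes "f \<in> Arr C" "W \<in> Obj C"
  shows "eval C W (Cod C f) \<cdot> (ihom_arr C W f \<star> Id C W) = f \<cdot> eval C W (Dom C f)"
  using assms by (simp add: ihom_arr_def)

lemma ihom_arr_Id:
  assumes [simp]: "A \<in> Obj C" "W \<in> Obj C"
  shows "ihom_arr C W (Id C A) = Id C (ihom C W A)"
proof (rule uncurry_inject)
  show "eval C W A \<cdot> (ihom_arr C W (Id C A) \<star> Id C W) = eval C W A \<cdot> (Id C (ihom C W A) \<star> Id C W)"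
    using eval_ihom_arr[of "Id C A" W] by simp
qed auto

lemma ihom_arr_Comp:
  assumes [simp]: "f \<in> Arr C" "g \<in> Arr C" "Dom C g = Cod C f" "W \<in> Obj C"
  shows "ihom_arr C W (g \<cdot> f) = ihom_arr C W g \<cdot> ihom_arr C W f"
proof (rule uncurry_inject)
  have "eval C W (Cod C g) \<cdot> ((ihom_arr C W g \<cdot> ihom_arr C W f) \<star> Id C W) =
    (eval C W (Cod C g) \<cdot> (ihom_arr C W g \<star> Id C W)) \<cdot> (ihom_arr C W f \<star> Id C W)"
    by (simp add: interchange)
  also have "\<dots> = g \<cdot> eval C W (Cod C f) \<cdot> (ihom_arr C W f \<star> Id C W)"
    by (subst eval_ihom_arr) auto
  also have "\<dots> = g \<cdot> f \<cdot> eval C W (Dom C f)"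
    by (simp add: eval_ihom_arr)
  finally show "eval C W (Cod C g) \<cdot> (ihom_arr C W (g \<cdot> f) \<star> Id C W) =
    eval C W (Cod C g) \<cdot> ((ihom_arr C W g \<cdot> ihom_arr C W f) \<star> Id C W)"
    using eval_ihom_arr[of "g \<cdot> f" W] by simp
qed auto

lemma nat_map_arr [simp]:
  assumes "W \<in> Obj C" "A \<in> Obj C"
  shows "nat_map C W A \<in> Arr C" "Dom C (nat_map C W A) = dual C W \<otimes> A"
    "Cod C (nat_map C W A) = ihom C W A"
  using assms by (simp_all add: nat_map_def)

lemma eval_nat_map:
  assumes "W \<in> Obj C" "A \<in> Obj C"
  shows "eval C W A \<cdot> (nat_map C W A \<star> Id C W) =
    runit C A \<cdot> (Id C A \<star> eval C W e) \<cdot> assoc C A (dual C W) W \<cdot> (braid C (dual C W) A \<star> Id C W)"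
  using assms by (simp add: nat_map_def)

lemma nat_map_natural:
  assumes [simp]: "W \<in> Obj C" "f \<in> Arr C"
  shows "nat_map C W (Cod C f) \<cdot> (Id C (dual C W) \<star> f) = ihom_arr C W f \<cdot> nat_map C W (Dom C f)"
proof (rule uncurry_inject)
  let ?A = "Dom C f" and ?B = "Cod C f" and ?D = "dual C W"
  have "eval C W ?B \<cdot> ((nat_map C W ?B \<cdot> (Id C ?D \<star> f)) \<star> Id C W) =
    (eval C W ?B \<cdot> (nat_map C W ?B \<star> Id C W)) \<cdot> ((Id C ?D \<star> f) \<star> Id C W)"
    by (simp add: interchange)
  also have "\<dots> = runit C ?B \<cdot> (Id C ?B \<star> eval C W e) \<cdot> assoc C ?B ?D W \<cdot>
      ((braid C ?D ?B \<cdot> (Id C ?D \<star> f)) \<star> Id C W)"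
    by (subst eval_nat_map) (auto simp: interchange)
  also have "braid C ?D ?B \<cdot> (Id C ?D \<star> f) = (f \<star> Id C ?D) \<cdot> braid C ?D ?A"
    by (rule braid_natural) auto
  also have "runit C ?B \<cdot> (Id C ?B \<star> eval C W e) \<cdot> assoc C ?B ?D W \<cdot>
      (((f \<star> Id C ?D) \<cdot> braid C ?D ?A) \<star> Id C W) =
    runit C ?B \<cdot> (Id C ?B \<star> eval C W e) \<cdot>
      (assoc C ?B ?D W \<cdot> ((f \<star> Id C ?D) \<star> Id C W)) \<cdot> (braid C ?D ?A \<star> Id C W)"
    by (simp add: interchange)
  also have "\<dots> = runit C ?B \<cdot> (Id C ?B \<star> eval C W e) \<cdot>
      ((f \<star> (Id C ?D \<star> Id C W)) \<cdot> assoc C ?A ?D W) \<cdot> (braid C ?D ?A \<star> Id C W)"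
    by (subst assoc_natural) auto
  also have "\<dots> = (runit C ?B \<cdot> (f \<star> Id C e)) \<cdot> (Id C ?A \<star> eval C W e) \<cdot>
      assoc C ?A ?D W \<cdot> (braid C ?D ?A \<star> Id C W)"
    by (simp add: interchange_extend)
  also have "\<dots> = f \<cdot> runit C ?A \<cdot> (Id C ?A \<star> eval C W e) \<cdot>
      assoc C ?A ?D W \<cdot> (braid C ?D ?A \<star> Id C W)"
    by (subst runit_natural) auto
  also have "\<dots> = (f \<cdot> eval C W ?A) \<cdot> (nat_map C W ?A \<star> Id C W)"
    by (simp add: eval_nat_map)
  also have "\<dots> = (eval C W ?B \<cdot> (ihom_arr C W f \<star> Id C W)) \<cdot> (nat_map C W ?A \<star> Id C W)"
    by (simp only: eval_ihom_arr assms)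
  also have "\<dots> = eval C W ?B \<cdot> ((ihom_arr C W f \<cdot> nat_map C W ?A) \<star> Id C W)"
    by (simp add: interchange)
  finally show "eval C W ?B \<cdot> ((nat_map C W ?B \<cdot> (Id C ?D \<star> f)) \<star> Id C W) =
    eval C W ?B \<cdot> ((ihom_arr C W f \<cdot> nat_map C W ?A) \<star> Id C W)" .
qed auto

text \<open>If \<open>ihom(X, u)\<close> factors through the natural morphism, then \<open>u\<close> is trace class: the image of the
  name of the identity of \<open>X\<close> is the required \<open>e \<rightarrow> X' \<otimes> X\<^sup>\<or>\<close>.\<close>

lemma trace_class_of_factorization:
  assumes [simp]: "X \<in> Obj C" "X' \<in> Obj C"
    and u: "u \<in> hom C X X'" and s: "s \<in> hom C (ihom C X X) (dual C X \<otimes> X')"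
    and eq: "nat_map C X X' \<cdot> s = ihom_arr C X u"
  shows "trace_class X X' u"
proof -
  have [simp]: "u \<in> Arr C" "Dom C u = X" "Cod C u = X'" "s \<in> Arr C"
    "Dom C s = ihom C X X" "Cod C s = dual C X \<otimes> X'"
    using u s by simp_all
  let ?D = "dual C X" and ?n = "curry C e X X (lunit C X)"
  let ?t = "braid C ?D X' \<cdot> s \<cdot> ?n"
  have "runit C X' \<cdot> transpose X' ?D ?t X (eval C X e) =
    (runit C X' \<cdot> (Id C X' \<star> eval C X e) \<cdot> assoc C X' ?D X \<cdot> (braid C ?D X' \<star> Id C X)) \<cdot>
      ((s \<cdot> ?n) \<star> Id C X) \<cdot> lunit_inv X"
    by (simp add: transpose_def interchange_extend)
  also have "\<dots> = (eval C X X' \<cdot> (nat_map C X X' \<star> Id C X)) \<cdot> ((s \<cdot> ?n) \<star> Id C X) \<cdot> lunit_inv X"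
    by (simp only: eval_nat_map assms)
  also have "\<dots> = eval C X X' \<cdot> (((nat_map C X X' \<cdot> s) \<cdot> ?n) \<star> Id C X) \<cdot> lunit_inv X"
    by (simp add: interchange_extend)
  also have "\<dots> = (eval C X X' \<cdot> (ihom_arr C X u \<star> Id C X)) \<cdot> (?n \<star> Id C X) \<cdot> lunit_inv X"
    unfolding eq by (simp add: interchange_extend)
  also have "\<dots> = u \<cdot> (eval C X X \<cdot> (?n \<star> Id C X)) \<cdot> lunit_inv X"
    using eval_ihom_arr[of u X] by (simp del: curry_arr(4))
  also have "\<dots> = u"
    by (subst curry_arr(4)) auto
  finally show ?thesis
    unfolding trace_class_def
    by (intro bexI[of _ ?D] bexI[of _ ?t] bexI[of _ "eval C X e"]) auto
qed

text \<open>Both ways of pairing \<open>D \<otimes> (X \<otimes> V)\<close> with \<open>W\<close>, where \<open>\<epsilon> : D \<otimes> X \<rightarrow> e\<close> and \<open>\<eta> : V \<otimes> W \<rightarrow> e\<close>,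
  amount to \<open>\<epsilon> \<otimes> \<eta>\<close>.\<close>

lemma pairing_coherence:
  assumes [simp]: "D \<in> Obj C" "X \<in> Obj C" "V \<in> Obj C" "W \<in> Obj C"
    "\<epsilon> \<in> Arr C" "Dom C \<epsilon> = D \<otimes> X" "Cod C \<epsilon> = e"
    "\<eta> \<in> Arr C" "Dom C \<eta> = V \<otimes> W" "Cod C \<eta> = e"
  shows "\<epsilon> \<cdot> (Id C D \<star> (runit C X \<cdot> (Id C X \<star> \<eta>) \<cdot> assoc C X V W)) \<cdot> assoc C D (X \<otimes> V) W =
    \<eta> \<cdot> ((lunit C V \<cdot> (\<epsilon> \<star> Id C V) \<cdot> assoc_inv D X V) \<star> Id C W)"
proof -
  let ?r = "assoc C (D \<otimes> X) V W \<cdot> (assoc_inv D X V \<star> Id C W)"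
  have runit: "Id C D \<star> runit C X = runit C (D \<otimes> X) \<cdot> assoc_inv D X e"
    by (subst runit_tens[symmetric]) auto
  have "\<epsilon> \<cdot> (Id C D \<star> (runit C X \<cdot> (Id C X \<star> \<eta>) \<cdot> assoc C X V W)) \<cdot> assoc C D (X \<otimes> V) W =
    \<epsilon> \<cdot> (Id C D \<star> runit C X) \<cdot> (Id C D \<star> (Id C X \<star> \<eta>)) \<cdot> (Id C D \<star> assoc C X V W) \<cdot>
      assoc C D (X \<otimes> V) W"
    by (simp add: interchange_extend)
  also have "\<dots> = \<epsilon> \<cdot> runit C (D \<otimes> X) \<cdot> (assoc_inv D X e \<cdot> (Id C D \<star> (Id C X \<star> \<eta>))) \<cdot>
      (Id C D \<star> assoc C X V W) \<cdot> assoc C D (X \<otimes> V) W"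
    by (simp add: runit)
  also have "\<dots> = \<epsilon> \<cdot> runit C (D \<otimes> X) \<cdot> (((Id C D \<star> Id C X) \<star> \<eta>) \<cdot> assoc_inv D X (V \<otimes> W)) \<cdot>
      (Id C D \<star> assoc C X V W) \<cdot> assoc C D (X \<otimes> V) W"
    using assoc_inv_natural[of "Id C D" "Id C X" \<eta>] by simp
  also have "\<dots> = \<epsilon> \<cdot> runit C (D \<otimes> X) \<cdot> (Id C (D \<otimes> X) \<star> \<eta>) \<cdot>
      (assoc_inv D X (V \<otimes> W) \<cdot> (Id C D \<star> assoc C X V W) \<cdot> assoc C D (X \<otimes> V) W)"
    by simp
  also have "\<dots> = (\<epsilon> \<cdot> runit C (D \<otimes> X)) \<cdot> (Id C (D \<otimes> X) \<star> \<eta>) \<cdot> ?r"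
    by (subst assoc_inv_pentagon) auto
  also have "\<dots> = (runit C e \<cdot> (\<epsilon> \<star> Id C e)) \<cdot> (Id C (D \<otimes> X) \<star> \<eta>) \<cdot> ?r"
    by (subst runit_natural) auto
  also have "\<dots> = (lunit C e \<cdot> (Id C e \<star> \<eta>)) \<cdot> (\<epsilon> \<star> (Id C V \<star> Id C W)) \<cdot> ?r"
    by (simp add: interchange_extend lunit_unit)
  also have "\<dots> = (\<eta> \<cdot> lunit C (V \<otimes> W)) \<cdot> (\<epsilon> \<star> (Id C V \<star> Id C W)) \<cdot> ?r"
    by (subst lunit_natural) auto
  also have "\<dots> = \<eta> \<cdot> lunit C (V \<otimes> W) \<cdot>
      ((\<epsilon> \<star> (Id C V \<star> Id C W)) \<cdot> assoc C (D \<otimes> X) V W) \<cdot> (assoc_inv D X V \<star> Id C W)"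
    by simp
  also have "\<dots> = \<eta> \<cdot> lunit C (V \<otimes> W) \<cdot>
      (assoc C e V W \<cdot> ((\<epsilon> \<star> Id C V) \<star> Id C W)) \<cdot> (assoc_inv D X V \<star> Id C W)"
    by (subst assoc_natural) auto
  also have "\<dots> = \<eta> \<cdot> (lunit C (V \<otimes> W) \<cdot> assoc C e V W) \<cdot>
      ((\<epsilon> \<star> Id C V) \<star> Id C W) \<cdot> (assoc_inv D X V \<star> Id C W)"
    by simp
  also have "\<dots> = \<eta> \<cdot> ((lunit C V \<cdot> (\<epsilon> \<star> Id C V) \<cdot> assoc_inv D X V) \<star> Id C W)"
    by (subst lunit_tens) (auto simp: interchange)
  finally show ?thesis .
qed

text \<open>The inverse up to \<open>u\<close> of the natural morphism is
  \<open>ihom(W, X) \<rightarrow> X' \<otimes> (D \<otimes> ihom(W, X)) \<rightarrow> X' \<otimes> W\<^sup>\<or> \<cong> W\<^sup>\<or> \<otimes> X'\<close>, where \<open>c : D \<otimes> ihom(W, X) \<rightarrow> W\<^sup>\<or>\<close> composes a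
  morphism \<open>W \<rightarrow> X\<close> with the functional on \<open>X\<close> that an element of \<open>D\<close> defines through \<open>\<epsilon>\<close>.\<close>

lemma factorization_of_trace_class:
  assumes u: "trace_class X X' u" and [simp]: "X \<in> Obj C" "X' \<in> Obj C" "W \<in> Obj C"
  shows "\<exists>s \<in> hom C (ihom C W X) (dual C W \<otimes> X').
    nat_map C W X' \<cdot> s = ihom_arr C W u \<and> s \<cdot> nat_map C W X = Id C (dual C W) \<star> u"
proof -
  obtain D t \<epsilon> where [simp]: "D \<in> Obj C" and t: "t \<in> hom C e (X' \<otimes> D)"
    and \<epsilon>: "\<epsilon> \<in> hom C (D \<otimes> X) e" and u_eq: "u = runit C X' \<cdot> transpose X' D t X \<epsilon>"
    using u unfolding trace_class_def by blast
  have [simp]: "t \<in> Arr C" "Dom C t = e" "Cod C t = X' \<otimes> D"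
    "\<epsilon> \<in> Arr C" "Dom C \<epsilon> = D \<otimes> X" "Cod C \<epsilon> = e"
    using t \<epsilon> by simp_all
  have [simp]: "u \<in> Arr C" "Dom C u = X" "Cod C u = X'"
    by (simp_all add: u_eq)
  let ?H = "ihom C W X" and ?V = "dual C W" and ?\<eta> = "eval C W e"
  define c where "c = curry C (D \<otimes> ?H) W e (\<epsilon> \<cdot> (Id C D \<star> eval C W X) \<cdot> assoc C D ?H W)"
  have [simp]: "c \<in> Arr C" "Dom C c = D \<otimes> ?H" "Cod C c = ?V"
    by (simp_all add: c_def)
  have eval_c: "?\<eta> \<cdot> (c \<star> Id C W) = \<epsilon> \<cdot> (Id C D \<star> eval C W X) \<cdot> assoc C D ?H W"
    by (simp add: c_def)
  define s' where "s' = transpose X' D t ?H c"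
  have [simp]: "s' \<in> Arr C" "Dom C s' = ?H" "Cod C s' = X' \<otimes> ?V"
    by (simp_all add: s'_def)
  define s where "s = braid C X' ?V \<cdot> s'"
  have "nat_map C W X' \<cdot> s = ihom_arr C W u"
  proof (rule uncurry_inject)
    have "eval C W X' \<cdot> ((nat_map C W X' \<cdot> s) \<star> Id C W) =
      (eval C W X' \<cdot> (nat_map C W X' \<star> Id C W)) \<cdot> (s \<star> Id C W)"
      by (simp add: interchange s_def)
    also have "\<dots> = runit C X' \<cdot> (Id C X' \<star> ?\<eta>) \<cdot> assoc C X' ?V W \<cdot> (s' \<star> Id C W)"
      by (simp add: eval_nat_map s_def interchange)
    also have "assoc C X' ?V W \<cdot> (s' \<star> Id C W) =
      transpose X' D t (?H \<otimes> W) ((c \<star> Id C W) \<cdot> assoc_inv D ?H W)"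
      unfolding s'_def using assoc_transpose[of X' D t c ?H W] by simp
    also have "(Id C X' \<star> ?\<eta>) \<cdot> \<dots> =
      transpose X' D t (?H \<otimes> W) ((?\<eta> \<cdot> (c \<star> Id C W)) \<cdot> assoc_inv D ?H W)"
      by (subst transpose_Comp_left) auto
    also have "(?\<eta> \<cdot> (c \<star> Id C W)) \<cdot> assoc_inv D ?H W = \<epsilon> \<cdot> (Id C D \<star> eval C W X)"
      by (simp only: eval_c) simp
    also have "transpose X' D t (?H \<otimes> W) \<dots> = transpose X' D t X \<epsilon> \<cdot> eval C W X"
      using transpose_Comp_right[of X' D t \<epsilon> "eval C W X"] by simp
    also have "runit C X' \<cdot> \<dots> = u \<cdot> eval C W X"
      by (simp add: u_eq)
    finally show "eval C W X' \<cdot> ((nat_map C W X' \<cdot> s) \<star> Id C W) =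
      eval C W X' \<cdot> (ihom_arr C W u \<star> Id C W)"
      using eval_ihom_arr[of u W] by simp
  qed (simp_all add: s_def)
  moreover have "s \<cdot> nat_map C W X = Id C ?V \<star> u"
  proof -
    define m where "m = nat_map C W X \<cdot> braid C X ?V"
    have [simp]: "m \<in> Arr C" "Dom C m = X \<otimes> ?V" "Cod C m = ?H"
      by (simp_all add: m_def)
    have eval_m: "eval C W X \<cdot> (m \<star> Id C W) = runit C X \<cdot> (Id C X \<star> ?\<eta>) \<cdot> assoc C X ?V W"
    proof -
      have "eval C W X \<cdot> (m \<star> Id C W) =
        (eval C W X \<cdot> (nat_map C W X \<star> Id C W)) \<cdot> (braid C X ?V \<star> Id C W)"
        by (simp add: m_def interchange)
      also have "\<dots> = runit C X \<cdot> (Id C X \<star> ?\<eta>) \<cdot> assoc C X ?V W"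
        by (simp add: eval_nat_map interchange braid_symmetric)
      finally show ?thesis .
    qed
    have c_m: "c \<cdot> (Id C D \<star> m) = lunit C ?V \<cdot> (\<epsilon> \<star> Id C ?V) \<cdot> assoc_inv D X ?V"
    proof (rule uncurry_inject)
      have "?\<eta> \<cdot> ((c \<cdot> (Id C D \<star> m)) \<star> Id C W) = (?\<eta> \<cdot> (c \<star> Id C W)) \<cdot> ((Id C D \<star> m) \<star> Id C W)"
        by (simp add: interchange)
      also have "\<dots> = \<epsilon> \<cdot> (Id C D \<star> eval C W X) \<cdot> (assoc C D ?H W \<cdot> ((Id C D \<star> m) \<star> Id C W))"
        by (simp add: eval_c)
      also have "\<dots> = \<epsilon> \<cdot> (Id C D \<star> eval C W X) \<cdot> ((Id C D \<star> (m \<star> Id C W)) \<cdot> assoc C D (X \<otimes> ?V) W)"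
        by (subst assoc_natural) auto
      also have "\<dots> = \<epsilon> \<cdot> (Id C D \<star> (eval C W X \<cdot> (m \<star> Id C W))) \<cdot> assoc C D (X \<otimes> ?V) W"
        by (simp add: interchange_extend)
      also have "\<dots> = ?\<eta> \<cdot> ((lunit C ?V \<cdot> (\<epsilon> \<star> Id C ?V) \<cdot> assoc_inv D X ?V) \<star> Id C W)"
        unfolding eval_m by (rule pairing_coherence) auto
      finally show "?\<eta> \<cdot> ((c \<cdot> (Id C D \<star> m)) \<star> Id C W) =
        ?\<eta> \<cdot> ((lunit C ?V \<cdot> (\<epsilon> \<star> Id C ?V) \<cdot> assoc_inv D X ?V) \<star> Id C W)" .
    qed auto
    have "s' \<cdot> m = transpose X' D t (X \<otimes> ?V) (c \<cdot> (Id C D \<star> m))"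
      unfolding s'_def using transpose_Comp_right[of X' D t c m] by simp
    also have "\<dots> = u \<star> Id C ?V"
      unfolding c_m u_eq by (rule transpose_contraction) auto
    finally have s'_m: "s' \<cdot> m = u \<star> Id C ?V" .
    have "s \<cdot> nat_map C W X = braid C X' ?V \<cdot> (s' \<cdot> m) \<cdot> braid C ?V X"
      by (simp add: s_def m_def braid_symmetric)
    also have "\<dots> = (braid C X' ?V \<cdot> (u \<star> Id C ?V)) \<cdot> braid C ?V X"
      by (simp add: s'_m)
    also have "\<dots> = ((Id C ?V \<star> u) \<cdot> braid C X ?V) \<cdot> braid C ?V X"
      by (subst braid_natural) auto
    also have "\<dots> = Id C ?V \<star> u"
      by (simp add: braid_symmetric)
    finally show ?thesis .
  qed
  ultimately show ?thesis
    by (intro bexI[of _ s]) (auto simp: s_def)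
qed

end

section \<open>Germs and morphisms of ind-objects\<close>

lemma prod_cat_simps [simp]:
  "Obj (prod_cat I J) = Obj I \<times> Obj J" "Arr (prod_cat I J) = Arr I \<times> Arr J"
  "Dom (prod_cat I J) (u, v) = (Dom I u, Dom J v)" "Cod (prod_cat I J) (u, v) = (Cod I u, Cod J v)"
  "Id (prod_cat I J) (i, j) = (Id I i, Id J j)"
  "(u', v') \<cdot>\<^bsub>prod_cat I J\<^esub> (u, v) = (u' \<cdot>\<^bsub>I\<^esub> u, v' \<cdot>\<^bsub>J\<^esub> v)"
  by (simp_all add: prod_cat_def)

lemma one_cat_simps [simp]: "Obj one_cat = UNIV" "Arr one_cat = UNIV"
  by (simp_all add: one_cat_def)

lemma filtered_one_cat: "filtered one_cat"
  by (auto simp: filtered_def category_def one_cat_def)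

lemma category_prod_cat:
  assumes "category I" "category J"
  shows "category (prod_cat I J)"
proof -
  interpret I: category I by fact
  interpret J: category J by fact
  show ?thesis
    by unfold_locales auto
qed

lemma filtered_prod_cat:
  assumes I: "filtered I" and J: "filtered J"
  shows "filtered (prod_cat I J)"
  unfolding filtered_def
proof (intro conjI ballI allI)
  show "category (prod_cat I J)"
    using assms by (simp add: filtered_def category_prod_cat)
  show "Obj (prod_cat I J) \<noteq> {}"
    using assms by (simp add: filtered_def)
next
  fix p q assume pq: "p \<in> Obj (prod_cat I J)" "q \<in> Obj (prod_cat I J)"
  obtain i j i' j' where eq: "p = (i, j)" "q = (i', j')"
    by (cases p, cases q) auto
  obtain k u u' where k: "k \<in> Obj I" "u \<in> hom I i k" "u' \<in> hom I i' k"
    using I pq unfolding filtered_def eq by (simp del: in_hom_iff) blast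
  obtain l v v' where l: "l \<in> Obj J" "v \<in> hom J j l" "v' \<in> hom J j' l"
    using J pq unfolding filtered_def eq by (simp del: in_hom_iff) blast
  have "(u, v) \<in> hom (prod_cat I J) p (k, l)" "(u', v') \<in> hom (prod_cat I J) q (k, l)"
    using k l by (simp_all add: eq)
  moreover have "(k, l) \<in> Obj (prod_cat I J)"
    using k(1) l(1) by simp
  ultimately show "\<exists>k \<in> Obj (prod_cat I J). hom (prod_cat I J) p k \<noteq> {} \<and> hom (prod_cat I J) q k \<noteq> {}"
    by blast
next
  fix p q f g assume fg: "f \<in> hom (prod_cat I J) p q" "g \<in> hom (prod_cat I J) p q"
  obtain i j i' j' where eq: "p = (i, j)" "q = (i', j')"
    by (cases p, cases q) auto
  obtain u v u' v' where eq': "f = (u, v)" "g = (u', v')"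
    by (cases f, cases g) auto
  have "u \<in> hom I i i'" "u' \<in> hom I i i'" "v \<in> hom J j j'" "v' \<in> hom J j j'"
    using fg by (simp_all add: eq eq')
  then obtain k w l x where "w \<in> hom I i' k" "w \<cdot>\<^bsub>I\<^esub> u = w \<cdot>\<^bsub>I\<^esub> u'"
    "x \<in> hom J j' l" "x \<cdot>\<^bsub>J\<^esub> v = x \<cdot>\<^bsub>J\<^esub> v'"
    using I J unfolding filtered_def by meson
  then show "\<exists>k. \<exists>w \<in> hom (prod_cat I J) q k. w \<cdot>\<^bsub>prod_cat I J\<^esub> f = w \<cdot>\<^bsub>prod_cat I J\<^esub> g"
    by (intro exI[of _ "(k, l)"] bexI[of _ "(w, x)"]) (auto simp: eq eq')
qed

lemma germI:
  "k \<in> Obj (Idx Y) \<Longrightarrow> g \<in> hom C A (ob Y k) \<Longrightarrow> u \<in> hom (Idx Y) j l \<Longrightarrow> v \<in> hom (Idx Y) k l \<Longrightarrow>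
   ar Y u \<cdot>\<^bsub>C\<^esub> f = ar Y v \<cdot>\<^bsub>C\<^esub> g \<Longrightarrow> (k, g) \<in> germ C A Y j f"
  unfolding germ_def by blast

text \<open>In a filtered category every span can be completed to a commutative square.\<close>

lemma filtered_span:
  assumes J: "filtered J" and u: "u \<in> hom J i j" and v: "v \<in> hom J i k"
  obtains l a b where "a \<in> hom J j l" "b \<in> hom J k l" "a \<cdot>\<^bsub>J\<^esub> u = b \<cdot>\<^bsub>J\<^esub> v"
proof -
  interpret category J
    using J by (simp add: filtered_def)
  have "j \<in> Obj J" "k \<in> Obj J"
    using u v by auto
  then obtain m a b where ab: "a \<in> hom J j m" "b \<in> hom J k m"
    using J unfolding filtered_def by blast
  then have "a \<cdot>\<^bsub>J\<^esub> u \<in> hom J i m" "b \<cdot>\<^bsub>J\<^esub> v \<in> hom J i m"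
    using u v by auto
  then obtain l w where w: "w \<in> hom J m l" "w \<cdot>\<^bsub>J\<^esub> (a \<cdot>\<^bsub>J\<^esub> u) = w \<cdot>\<^bsub>J\<^esub> (b \<cdot>\<^bsub>J\<^esub> v)"
    using J unfolding filtered_def by meson
  show thesis
    by (rule that[of "w \<cdot>\<^bsub>J\<^esub> a" l "w \<cdot>\<^bsub>J\<^esub> b"]) (use ab u v w in auto)
qed

lemma diagram_simps:
  assumes "is_diagram C D"
  shows "i \<in> Obj (Idx D) \<Longrightarrow> ob D i \<in> Obj C"
    "u \<in> Arr (Idx D) \<Longrightarrow> ar D u \<in> Arr C"
    "u \<in> Arr (Idx D) \<Longrightarrow> Dom C (ar D u) = ob D (Dom (Idx D) u)"
    "u \<in> Arr (Idx D) \<Longrightarrow> Cod C (ar D u) = ob D (Cod (Idx D) u)"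
    "i \<in> Obj (Idx D) \<Longrightarrow> ar D (Id (Idx D) i) = Id C (ob D i)"
    "u \<in> Arr (Idx D) \<Longrightarrow> v \<in> Arr (Idx D) \<Longrightarrow> Dom (Idx D) v = Cod (Idx D) u \<Longrightarrow>
      ar D (v \<cdot>\<^bsub>Idx D\<^esub> u) = ar D v \<cdot>\<^bsub>C\<^esub> ar D u"
  using assms unfolding is_diagram_def by auto

lemma ind_objectD:
  assumes "ind_object C X"
  shows "is_diagram C X" "category (Idx X)" "filtered (Idx X)"
  using assms by (simp_all add: ind_object_def is_diagram_def)

context category
begin

context
  fixes Y :: "('j, 'n, 'o, 'a) diagram"
  assumes Y: "ind_object C Y"
begin

interpretation J: category "Idx Y"
  using ind_objectD[OF Y] by simp

lemmas Y_simps = diagram_simps[OF ind_objectD(1)[OF Y]]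

lemma germ_refl: "j \<in> Obj (Idx Y) \<Longrightarrow> f \<in> hom C A (ob Y j) \<Longrightarrow> (j, f) \<in> germ C A Y j f"
  unfolding germ_def by (auto intro!: exI[of _ j] bexI[of _ "Id (Idx Y) j"])

lemma germ_sym:
  "(k, g) \<in> germ C A Y j f \<Longrightarrow> j \<in> Obj (Idx Y) \<Longrightarrow> f \<in> hom C A (ob Y j) \<Longrightarrow> (j, f) \<in> germ C A Y k g"
  unfolding germ_def by (simp del: in_hom_iff) metis

lemma germ_trans:
  assumes gf: "(k, g) \<in> germ C A Y j f" and hg: "(m, h) \<in> germ C A Y k g"
    and f: "f \<in> hom C A (ob Y j)"
  shows "(m, h) \<in> germ C A Y j f"
proof -
  from gf obtain p u v where g: "g \<in> hom C A (ob Y k)"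
    and u: "u \<in> hom (Idx Y) j p" and v: "v \<in> hom (Idx Y) k p" and uv: "ar Y u \<cdot> f = ar Y v \<cdot> g"
    unfolding germ_def by blast
  from hg obtain q u' v' where m: "m \<in> Obj (Idx Y)" and h: "h \<in> hom C A (ob Y m)"
    and u': "u' \<in> hom (Idx Y) k q" and v': "v' \<in> hom (Idx Y) m q"
    and uv': "ar Y u' \<cdot> g = ar Y v' \<cdot> h"
    unfolding germ_def by blast
  obtain l a b where a: "a \<in> hom (Idx Y) p l" and b: "b \<in> hom (Idx Y) q l"
    and ab: "a \<cdot>\<^bsub>Idx Y\<^esub> v = b \<cdot>\<^bsub>Idx Y\<^esub> u'"
    by (rule filtered_span[OF ind_objectD(3)[OF Y] v u'])
  have "ar Y (a \<cdot>\<^bsub>Idx Y\<^esub> u) \<cdot> f = ar Y a \<cdot> (ar Y u \<cdot> f)"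
    using a u f by (simp add: Y_simps)
  also have "\<dots> = ar Y (a \<cdot>\<^bsub>Idx Y\<^esub> v) \<cdot> g"
    using a v g by (simp add: Y_simps uv)
  also have "\<dots> = ar Y b \<cdot> (ar Y u' \<cdot> g)"
    unfolding ab using b u' g by (simp add: Y_simps)
  also have "\<dots> = ar Y (b \<cdot>\<^bsub>Idx Y\<^esub> v') \<cdot> h"
    using b v' h by (simp add: Y_simps uv')
  finally have eq: "ar Y (a \<cdot>\<^bsub>Idx Y\<^esub> u) \<cdot> f = ar Y (b \<cdot>\<^bsub>Idx Y\<^esub> v') \<cdot> h" .
  show ?thesis
    by (rule germI[OF m h _ _ eq, of _ l]) (use a b u v' in auto)
qed

lemma germ_eqI:
  assumes gf: "(k, g) \<in> germ C A Y j f" and j: "j \<in> Obj (Idx Y)" and f: "f \<in> hom C A (ob Y j)"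
  shows "germ C A Y k g = germ C A Y j f"
proof -
  have g: "g \<in> hom C A (ob Y k)"
    using gf unfolding germ_def by blast
  show ?thesis
    using germ_trans[OF gf _ f] germ_trans[OF germ_sym[OF gf j f] _ g] by auto
qed

lemma germ_push:
  assumes "u \<in> hom (Idx Y) j k" "f \<in> hom C A (ob Y j)"
  shows "germ C A Y k (ar Y u \<cdot> f) = germ C A Y j f"
proof (rule germ_eqI)
  have "k \<in> Obj (Idx Y)" "Id (Idx Y) k \<in> hom (Idx Y) k k" "ar Y u \<cdot> f \<in> hom C A (ob Y k)"
    "ar Y u \<cdot> f = ar Y (Id (Idx Y) k) \<cdot> ar Y u \<cdot> f"
    using assms by (auto simp: Y_simps)
  then show "(k, ar Y u \<cdot> f) \<in> germ C A Y j f"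
    unfolding germ_def using assms(1) by blast
qed (use assms in auto)

lemma germ_precomp:
  assumes "(k, g) \<in> germ C B Y j f" "h \<in> hom C A B" "f \<in> hom C B (ob Y j)"
  shows "(k, g \<cdot> h) \<in> germ C A Y j (f \<cdot> h)"
proof -
  from assms(1) obtain p u v where k: "k \<in> Obj (Idx Y)" and g: "g \<in> hom C B (ob Y k)"
    and u: "u \<in> hom (Idx Y) j p" and v: "v \<in> hom (Idx Y) k p" and uv: "ar Y u \<cdot> f = ar Y v \<cdot> g"
    unfolding germ_def by blast
  have "ar Y u \<cdot> (f \<cdot> h) = (ar Y u \<cdot> f) \<cdot> h"
    using assms(2,3) u by (simp add: Y_simps)
  also have "\<dots> = ar Y v \<cdot> (g \<cdot> h)"
    unfolding uv using assms(2) g v by (simp add: Y_simps)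
  finally have eq: "ar Y u \<cdot> (f \<cdot> h) = ar Y v \<cdot> (g \<cdot> h)" .
  show ?thesis
    by (rule germI[OF k _ u v eq]) (use g assms(2) in auto)
qed

lemma germsE:
  assumes "S \<in> germs C A Y"
  obtains j f where "S = germ C A Y j f" "j \<in> Obj (Idx Y)" "f \<in> hom C A (ob Y j)"
  using assms unfolding germs_def by blast

lemma germ_of_member:
  assumes "S \<in> germs C A Y" "(j, f) \<in> S"
  shows "S = germ C A Y j f" "j \<in> Obj (Idx Y)" "f \<in> hom C A (ob Y j)"
proof -
  obtain k g where S: "S = germ C A Y k g" "k \<in> Obj (Idx Y)" "g \<in> hom C A (ob Y k)"
    using assms(1) by (rule germsE)
  then show "S = germ C A Y j f"
    using germ_eqI[of j f A k g] assms(2) by simp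
  show "j \<in> Obj (Idx Y)" "f \<in> hom C A (ob Y j)"
    using assms(2) unfolding S(1) germ_def by blast+
qed

end

text \<open>Composition of germs does not depend on the choice of representatives.\<close>

lemma ind_comp_germ:
  assumes Y: "ind_object C Y" and Z: "ind_object C Z" and \<psi>: "\<psi> \<in> ind_hom C Y Z"
    and \<phi>i: "\<phi> i = germ C (ob X i) Y j f" and f: "j \<in> Obj (Idx Y)" "f \<in> hom C (ob X i) (ob Y j)"
    and \<psi>j: "\<psi> j = germ C (ob Y j) Z k g" and g: "k \<in> Obj (Idx Z)" "g \<in> hom C (ob Y j) (ob Z k)"
  shows "ind_comp C X Z \<psi> \<phi> i = germ C (ob X i) Z k (g \<cdot> f)"
proof -
  note Y_simps = diagram_simps[OF ind_objectD(1)[OF Y]]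
  let ?A = "ob X i"
  have compat: "(m, h \<cdot> ar Y u) \<in> \<psi> j'" if "(m, h) \<in> \<psi> l" "u \<in> hom (Idx Y) j' l" for m h u j' l
    using \<psi> that unfolding ind_hom_def by auto
  have germs: "\<psi> j' \<in> germs C (ob Y j') Z" if "j' \<in> Obj (Idx Y)" for j'
    using \<psi> that unfolding ind_hom_def by blast
  have "germ C ?A Z k' (g' \<cdot> f') = germ C ?A Z k (g \<cdot> f)"
    if f': "(j', f') \<in> \<phi> i" and g': "(k', g') \<in> \<psi> j'" for j' f' k' g'
  proof -
    from f' obtain l u v where j': "j' \<in> Obj (Idx Y)" "f' \<in> hom C ?A (ob Y j')"
      and u: "u \<in> hom (Idx Y) j l" and v: "v \<in> hom (Idx Y) j' l" and uv: "ar Y u \<cdot> f = ar Y v \<cdot> f'"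
      unfolding \<phi>i germ_def by blast
    interpret J: category "Idx Y"
      using ind_objectD[OF Y] by simp
    have l: "l \<in> Obj (Idx Y)"
      using u by auto
    obtain m h where \<psi>l: "\<psi> l = germ C (ob Y l) Z m h" and h: "m \<in> Obj (Idx Z)" "h \<in> hom C (ob Y l) (ob Z m)"
      by (rule germsE[OF Z germs[OF l]])
    have mh: "(m, h) \<in> \<psi> l"
      unfolding \<psi>l by (rule germ_refl[OF Z h])
    \<comment> \<open>Both composites have the germ of \<open>h \<cdot> ar Y u \<cdot> f = h \<cdot> ar Y v \<cdot> f'\<close>, which passes through the stage \<open>l\<close>.\<close>
    have "(m, h \<cdot> ar Y u) \<in> germ C (ob Y j) Z k g"
      using compat[OF mh u] by (simp add: \<psi>j)
    then have "(m, (h \<cdot> ar Y u) \<cdot> f) \<in> germ C ?A Z k (g \<cdot> f)"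
      by (rule germ_precomp[OF Z _ f(2) g(2)])
    then have 1: "germ C ?A Z m ((h \<cdot> ar Y u) \<cdot> f) = germ C ?A Z k (g \<cdot> f)"
      by (rule germ_eqI[OF Z]) (use f g in auto)
    have g'_typed: "k' \<in> Obj (Idx Z)" "g' \<in> hom C (ob Y j') (ob Z k')"
      and \<psi>j': "\<psi> j' = germ C (ob Y j') Z k' g'"
      using germ_of_member[OF Z germs[OF j'(1)] g'] by simp_all
    have "(m, h \<cdot> ar Y v) \<in> germ C (ob Y j') Z k' g'"
      using compat[OF mh v] by (simp add: \<psi>j')
    then have "(m, (h \<cdot> ar Y v) \<cdot> f') \<in> germ C ?A Z k' (g' \<cdot> f')"
      by (rule germ_precomp[OF Z _ j'(2) g'_typed(2)])
    then have 2: "germ C ?A Z m ((h \<cdot> ar Y v) \<cdot> f') = germ C ?A Z k' (g' \<cdot> f')"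
      by (rule germ_eqI[OF Z]) (use j' g'_typed in auto)
    have "(h \<cdot> ar Y u) \<cdot> f = (h \<cdot> ar Y v) \<cdot> f'"
      using h u v f j' uv by (simp add: Y_simps)
    with 1 2 show ?thesis by simp
  qed
  moreover have "(j, f) \<in> \<phi> i"
    unfolding \<phi>i by (rule germ_refl[OF Y f])
  moreover have "(k, g) \<in> \<psi> j"
    unfolding \<psi>j by (rule germ_refl[OF Z g])
  ultimately show ?thesis
    unfolding ind_comp_def by blast
qed

end

section \<open>Levelwise isomorphisms of ind-objects\<close>

text \<open>The morphism of ind-objects given by a family of arrows \<open>n j : P\<^sub>j \<rightarrow> Q\<^sub>j\<close>. The index category of \<open>P\<close>
  is \<open>1 \<times> J\<close> where that of \<open>Q\<close> is \<open>J\<close>, as is the case for the two sides of the natural morphism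
  \<open>ind_nat_map\<close>.\<close>

definition levelwise ::
  "('o, 'a, 'z) cat_scheme \<Rightarrow> (unit \<times> 'j, unit \<times> 'n, 'o, 'a) diagram \<Rightarrow> ('j, 'n, 'o, 'a) diagram \<Rightarrow>
   ('j \<Rightarrow> 'a) \<Rightarrow> unit \<times> 'j \<Rightarrow> ('j \<times> 'a) set" where
  "levelwise C P Q n = (\<lambda>(_, j). if j \<in> Obj (Idx Q) then germ C (ob P ((), j)) Q j (n j) else {})"

context category
begin

context
  fixes P :: "(unit \<times> 'j, unit \<times> 'n, 'o, 'a) diagram" and Q :: "('j, 'n, 'o, 'a) diagram"
    and n :: "'j \<Rightarrow> 'a"
  assumes P: "ind_object C P" and Q: "ind_object C Q"
    and Idx_P: "Idx P = prod_cat one_cat (Idx Q)"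
    and n_typed: "\<And>j. j \<in> Obj (Idx Q) \<Longrightarrow> n j \<in> hom C (ob P ((), j)) (ob Q j)"
    and n_natural: "\<And>u. u \<in> Arr (Idx Q) \<Longrightarrow>
      n (Cod (Idx Q) u) \<cdot> ar P ((), u) = ar Q u \<cdot> n (Dom (Idx Q) u)"
begin

interpretation J: category "Idx Q"
  using ind_objectD[OF Q] by simp

lemmas Q_simps = diagram_simps[OF ind_objectD(1)[OF Q]]

lemma P_simps:
  "i \<in> Obj (Idx Q) \<Longrightarrow> ob P ((), i) \<in> Obj C"
  "u \<in> Arr (Idx Q) \<Longrightarrow> ar P ((), u) \<in> Arr C"
  "u \<in> Arr (Idx Q) \<Longrightarrow> Dom C (ar P ((), u)) = ob P ((), Dom (Idx Q) u)"
  "u \<in> Arr (Idx Q) \<Longrightarrow> Cod C (ar P ((), u)) = ob P ((), Cod (Idx Q) u)"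
  "u \<in> Arr (Idx Q) \<Longrightarrow> v \<in> Arr (Idx Q) \<Longrightarrow> Dom (Idx Q) v = Cod (Idx Q) u \<Longrightarrow>
    ar P ((), v \<cdot>\<^bsub>Idx Q\<^esub> u) = ar P ((), v) \<cdot> ar P ((), u)"
  using diagram_simps(1)[OF ind_objectD(1)[OF P], of "((), i)"]
    diagram_simps(2,3,4)[OF ind_objectD(1)[OF P], of "((), u)"]
    diagram_simps(6)[OF ind_objectD(1)[OF P], of "((), u)" "((), v)"]
  by (simp_all add: Idx_P)

lemma n_simps:
  "j \<in> Obj (Idx Q) \<Longrightarrow> n j \<in> Arr C" "j \<in> Obj (Idx Q) \<Longrightarrow> Dom C (n j) = ob P ((), j)"
  "j \<in> Obj (Idx Q) \<Longrightarrow> Cod C (n j) = ob Q j"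
  using n_typed by simp_all

lemma n_natural_extend:
  "u \<in> Arr (Idx Q) \<Longrightarrow> f \<in> Arr C \<Longrightarrow> Cod C f = ob P ((), Dom (Idx Q) u) \<Longrightarrow>
   n (Cod (Idx Q) u) \<cdot> ar P ((), u) \<cdot> f = ar Q u \<cdot> n (Dom (Idx Q) u) \<cdot> f"
  using Comp_extend[OF n_natural, of u f] by (simp add: P_simps Q_simps n_simps)

lemma hom_P: "w \<in> hom (Idx Q) j k \<Longrightarrow> ((), w) \<in> hom (Idx P) ((), j) ((), k)"
  by (simp add: Idx_P)

lemma levelwise_in_ind_hom: "levelwise C P Q n \<in> ind_hom C P Q"
  unfolding ind_hom_def
proof (intro CollectI conjI ballI allI impI)
  fix i assume "i \<in> Obj (Idx P)"
  then show "levelwise C P Q n i \<in> germs C (ob P i) Q"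
    using n_typed unfolding levelwise_def germs_def Idx_P by (cases i) auto
next
  fix i assume "i \<notin> Obj (Idx P)"
  then show "levelwise C P Q n i = {}"
    unfolding levelwise_def Idx_P by (cases i) auto
next
  fix u x assume u: "u \<in> Arr (Idx P)" and x: "x \<in> levelwise C P Q n (Cod (Idx P) u)"
  obtain v where v: "u = ((), v)" "v \<in> Arr (Idx Q)"
    using u by (cases u) (simp add: Idx_P)
  let ?i = "Dom (Idx Q) v" and ?k = "Cod (Idx Q) v"
  obtain j f where jf: "x = (j, f)" by (cases x)
  have "(j, f) \<in> germ C (ob P ((), ?k)) Q ?k (n ?k)"
    using x v jf by (simp add: levelwise_def Idx_P)
  then have "(j, f \<cdot> ar P ((), v)) \<in> germ C (ob P ((), ?i)) Q ?k (n ?k \<cdot> ar P ((), v))"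
    by (rule germ_precomp[OF Q]) (use v in \<open>auto simp: P_simps n_simps\<close>)
  also have "n ?k \<cdot> ar P ((), v) = ar Q v \<cdot> n ?i"
    using v by (simp add: n_natural)
  also have "germ C (ob P ((), ?i)) Q ?k \<dots> = germ C (ob P ((), ?i)) Q ?i (n ?i)"
    by (rule germ_push[OF Q]) (use v in \<open>auto simp: n_simps\<close>)
  finally show "case x of (j, f) \<Rightarrow> (j, f \<cdot> ar P u) \<in> levelwise C P Q n (Dom (Idx P) u)"
    using v by (simp add: levelwise_def Idx_P jf)
qed

lemma levelwise_iso_imp_section:
  assumes iso: "ind_iso C P Q (levelwise C P Q n)" and j: "j \<in> Obj (Idx Q)"
  shows "\<exists>k. \<exists>w \<in> hom (Idx Q) j k. \<exists>s \<in> hom C (ob Q j) (ob P ((), k)). n k \<cdot> s = ar Q w"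
proof -
  let ?A = "ob Q j"
  obtain \<psi> where \<psi>: "\<psi> \<in> ind_hom C Q P" and inv: "ind_comp C Q Q (levelwise C P Q n) \<psi> = ind_id C Q"
    using iso unfolding ind_iso_def by blast
  have "\<psi> j \<in> germs C ?A P"
    using \<psi> j unfolding ind_hom_def by blast
  then obtain x g where \<psi>j: "\<psi> j = germ C ?A P x g" and x: "x \<in> Obj (Idx P)" and g: "g \<in> hom C ?A (ob P x)"
    by (rule germsE[OF P])
  obtain k where x_eq: "x = ((), k)" and k: "k \<in> Obj (Idx Q)"
    using x by (cases x) (simp add: Idx_P)
  have "ind_comp C Q Q (levelwise C P Q n) \<psi> j = germ C ?A Q k (n k \<cdot> g)"
    by (rule ind_comp_germ[where X = Q and i = j and \<phi> = \<psi>, OF P Q levelwise_in_ind_hom \<psi>j x g])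
      (use x_eq k n_typed in \<open>simp_all add: levelwise_def\<close>)
  then have "germ C ?A Q j (Id C ?A) = germ C ?A Q k (n k \<cdot> g)"
    using inv j by (simp add: ind_id_def)
  moreover have "(k, n k \<cdot> g) \<in> germ C ?A Q k (n k \<cdot> g)"
    by (rule germ_refl[OF Q k]) (use g x_eq k in \<open>simp add: n_simps\<close>)
  ultimately have "(k, n k \<cdot> g) \<in> germ C ?A Q j (Id C ?A)"
    by simp
  then obtain l u v where u: "u \<in> hom (Idx Q) j l" and v: "v \<in> hom (Idx Q) k l"
    and uv: "ar Q u \<cdot> Id C ?A = ar Q v \<cdot> n k \<cdot> g"
    unfolding germ_def by blast
  have "n l \<cdot> ar P ((), v) \<cdot> g = ar Q u"
    using n_natural_extend[of v g] u v g x_eq uv by (simp add: Q_simps)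
  then show ?thesis
    using u v g x_eq by (intro exI[of _ l] bexI[of _ u] bexI[of _ "ar P ((), v) \<cdot> g"]) (auto simp: P_simps)
qed

text \<open>The local inverses \<open>s\<close> are compatible as germs because two arrows into \<open>P\<^sub>l\<close> that \<open>n l\<close>
  identifies become equal at a later stage, namely after composition with \<open>s : Q\<^sub>l \<rightarrow> P\<^sub>k\<close>.\<close>

lemma sections_imp_levelwise_iso:
  assumes "\<And>j. j \<in> Obj (Idx Q) \<Longrightarrow> \<exists>k. \<exists>w \<in> hom (Idx Q) j k. \<exists>s \<in> hom C (ob Q j) (ob P ((), k)).
    n k \<cdot> s = ar Q w \<and> s \<cdot> n j = ar P ((), w)"
  shows "ind_iso C P Q (levelwise C P Q n)"
proof -
  obtain K w s where
    *: "\<And>j. j \<in> Obj (Idx Q) \<Longrightarrow> w j \<in> hom (Idx Q) j (K j) \<and> s j \<in> hom C (ob Q j) (ob P ((), K j)) \<and>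
      n (K j) \<cdot> s j = ar Q (w j) \<and> s j \<cdot> n j = ar P ((), w j)"
    using assms by metis
  have w: "w j \<in> hom (Idx Q) j (K j)" and s: "s j \<in> hom C (ob Q j) (ob P ((), K j))"
    and n_s: "n (K j) \<cdot> s j = ar Q (w j)" and s_n: "s j \<cdot> n j = ar P ((), w j)"
    if "j \<in> Obj (Idx Q)" for j
    using *[OF that] by simp_all
  have [simp]: "w j \<in> Arr (Idx Q)" "Dom (Idx Q) (w j) = j" "Cod (Idx Q) (w j) = K j"
    "s j \<in> Arr C" "Dom C (s j) = ob Q j" "Cod C (s j) = ob P ((), K j)"
    if "j \<in> Obj (Idx Q)" for j
    using w[OF that] s[OF that] by simp_all
  have K: "K j \<in> Obj (Idx Q)" if "j \<in> Obj (Idx Q)" for j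
    using w[OF that] J.Cod_in_Obj[of "w j"] by simp
  define \<psi> where "\<psi> = (\<lambda>j. if j \<in> Obj (Idx Q) then germ C (ob Q j) P ((), K j) (s j) else {})"
  have mono: "ar P ((), w l) \<cdot> f = ar P ((), w l) \<cdot> g"
    if "l \<in> Obj (Idx Q)" "f \<in> hom C A (ob P ((), l))" "g \<in> hom C A (ob P ((), l))" "n l \<cdot> f = n l \<cdot> g"
    for l f g A
  proof -
    have "s l \<cdot> n l \<cdot> f = s l \<cdot> n l \<cdot> g"
      by (simp add: that(4))
    then show ?thesis
      using Comp_extend[OF s_n, of l f] Comp_extend[OF s_n, of l g] that by (simp add: n_simps)
  qed
  have compat: "germ C (ob Q (Dom (Idx Q) u)) P ((), K (Cod (Idx Q) u)) (s (Cod (Idx Q) u) \<cdot> ar Q u)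
    = \<psi> (Dom (Idx Q) u)" if u: "u \<in> Arr (Idx Q)" for u
  proof -
    let ?i = "Dom (Idx Q) u" and ?j = "Cod (Idx Q) u"
    have ij: "?i \<in> Obj (Idx Q)" "?j \<in> Obj (Idx Q)" using u by simp_all
    have "w ?j \<cdot>\<^bsub>Idx Q\<^esub> u \<in> hom (Idx Q) ?i (K ?j)"
      using u by simp
    then obtain l a b where a: "a \<in> hom (Idx Q) (K ?i) l" and b: "b \<in> hom (Idx Q) (K ?j) l"
      and ab: "a \<cdot>\<^bsub>Idx Q\<^esub> w ?i = b \<cdot>\<^bsub>Idx Q\<^esub> (w ?j \<cdot>\<^bsub>Idx Q\<^esub> u)"
      by (rule filtered_span[OF ind_objectD(3)[OF Q] w[OF ij(1)]])
    have l: "l \<in> Obj (Idx Q)" using a by auto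
    have "n l \<cdot> ar P ((), a) \<cdot> s ?i = ar Q a \<cdot> n (K ?i) \<cdot> s ?i"
      using n_natural_extend[of a "s ?i"] a ij by simp
    also have "\<dots> = ar Q (a \<cdot>\<^bsub>Idx Q\<^esub> w ?i)"
      using a ij by (simp add: n_s Q_simps)
    also have "\<dots> = ar Q b \<cdot> (n (K ?j) \<cdot> s ?j) \<cdot> ar Q u"
      unfolding ab using b ij u by (simp only: n_s) (simp add: Q_simps)
    also have "\<dots> = n l \<cdot> ar P ((), b) \<cdot> s ?j \<cdot> ar Q u"
      using n_natural_extend[of b "s ?j \<cdot> ar Q u"] b ij u K by (simp add: Q_simps n_simps)
    finally have "ar P ((), w l) \<cdot> ar P ((), a) \<cdot> s ?i = ar P ((), w l) \<cdot> ar P ((), b) \<cdot> s ?j \<cdot> ar Q u"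
      by (rule mono[OF l, rotated 2]) (use a b u ij in \<open>auto simp: P_simps Q_simps\<close>)
    then have eq: "ar P ((), w l \<cdot>\<^bsub>Idx Q\<^esub> a) \<cdot> s ?i = ar P ((), w l \<cdot>\<^bsub>Idx Q\<^esub> b) \<cdot> s ?j \<cdot> ar Q u"
      using a b u ij l by (simp add: P_simps Q_simps)
    have "germ C (ob Q ?i) P ((), K ?j) (s ?j \<cdot> ar Q u) =
      germ C (ob Q ?i) P ((), K l) (ar P ((), w l \<cdot>\<^bsub>Idx Q\<^esub> b) \<cdot> s ?j \<cdot> ar Q u)"
      by (rule germ_push[OF P hom_P, symmetric]) (use b l u in \<open>auto simp: Q_simps\<close>)
    also have "\<dots> = germ C (ob Q ?i) P ((), K l) (ar P ((), w l \<cdot>\<^bsub>Idx Q\<^esub> a) \<cdot> s ?i)"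
      by (simp only: eq)
    also have "\<dots> = germ C (ob Q ?i) P ((), K ?i) (s ?i)"
      by (rule germ_push[OF P hom_P]) (use a l ij in auto)
    finally show ?thesis
      using ij by (simp add: \<psi>_def)
  qed
  have \<psi>_hom: "\<psi> \<in> ind_hom C Q P"
    unfolding ind_hom_def
  proof (intro CollectI conjI ballI allI impI)
    fix i assume i: "i \<in> Obj (Idx Q)"
    then have "((), K i) \<in> Obj (Idx P)"
      by (simp add: Idx_P K)
    then show "\<psi> i \<in> germs C (ob Q i) P"
      using s[OF i] i unfolding \<psi>_def germs_def mem_Collect_eq
      by (intro exI[of _ "((), K i)"] exI[of _ "s i"]) simp
  next
    fix i assume "i \<notin> Obj (Idx Q)"
    then show "\<psi> i = {}"
      by (simp add: \<psi>_def)
  next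
    fix u x assume u: "u \<in> Arr (Idx Q)" and x: "x \<in> \<psi> (Cod (Idx Q) u)"
    obtain k f where kf: "x = (k, f)" by (cases x)
    have "(k, f) \<in> germ C (ob Q (Cod (Idx Q) u)) P ((), K (Cod (Idx Q) u)) (s (Cod (Idx Q) u))"
      using u x kf by (simp add: \<psi>_def)
    then have "(k, f \<cdot> ar Q u) \<in>
      germ C (ob Q (Dom (Idx Q) u)) P ((), K (Cod (Idx Q) u)) (s (Cod (Idx Q) u) \<cdot> ar Q u)"
      by (rule germ_precomp[OF P]) (use u in \<open>auto simp: Q_simps\<close>)
    then show "case x of (k, f) \<Rightarrow> (k, f \<cdot> ar Q u) \<in> \<psi> (Dom (Idx Q) u)"
      by (simp add: kf compat[OF u])
  qed
  have "ind_comp C P P \<psi> (levelwise C P Q n) = ind_id C P"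
  proof
    fix x :: "unit \<times> 'j"
    obtain j where x: "x = ((), j)" by (cases x) auto
    show "ind_comp C P P \<psi> (levelwise C P Q n) x = ind_id C P x"
    proof (cases "j \<in> Obj (Idx Q)")
      case True
      have "ind_comp C P P \<psi> (levelwise C P Q n) x = germ C (ob P x) P ((), K j) (s j \<cdot> n j)"
        by (rule ind_comp_germ[OF Q P \<psi>_hom _ True])
          (use True s n_typed K in \<open>simp_all add: levelwise_def \<psi>_def x Idx_P\<close>)
      also have "s j \<cdot> n j = ar P ((), w j) \<cdot> Id C (ob P x)"
        using True by (simp add: s_n x P_simps)
      also have "germ C (ob P x) P ((), K j) \<dots> = germ C (ob P x) P ((), j) (Id C (ob P x))"
        by (rule germ_push[OF P hom_P]) (use True x in \<open>auto simp: P_simps\<close>)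
      finally show ?thesis
        using True by (simp add: ind_id_def x Idx_P)
    next
      case False
      then show ?thesis
        by (simp add: ind_comp_def ind_id_def levelwise_def x Idx_P)
    qed
  qed
  moreover have "ind_comp C Q Q (levelwise C P Q n) \<psi> = ind_id C Q"
  proof
    fix j
    show "ind_comp C Q Q (levelwise C P Q n) \<psi> j = ind_id C Q j"
    proof (cases "j \<in> Obj (Idx Q)")
      case True
      have "ind_comp C Q Q (levelwise C P Q n) \<psi> j = germ C (ob Q j) Q (K j) (n (K j) \<cdot> s j)"
        by (rule ind_comp_germ[OF P Q levelwise_in_ind_hom])
          (use True s n_typed K in \<open>simp_all add: levelwise_def \<psi>_def Idx_P\<close>)
      also have "n (K j) \<cdot> s j = ar Q (w j) \<cdot> Id C (ob Q j)"
        using True by (simp add: n_s Q_simps)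
      also have "germ C (ob Q j) Q (K j) \<dots> = germ C (ob Q j) Q j (Id C (ob Q j))"
        by (rule germ_push[OF Q w]) (use True in \<open>auto simp: Q_simps\<close>)
      finally show ?thesis
        using True by (simp add: ind_id_def)
    next
      case False
      then show ?thesis
        by (simp add: ind_comp_def ind_id_def \<psi>_def)
    qed
  qed
  ultimately show ?thesis
    unfolding ind_iso_def using levelwise_in_ind_hom \<psi>_hom by blast
qed

end

end

section \<open>Nuclear ind-objects\<close>

lemma ind_object_ind_tens:
  assumes "symmetric_monoidal_category C" "ind_object C X" "ind_object C Y"
  shows "ind_object C (ind_tens C X Y)"
proof -
  interpret symmetric_monoidal_category C by fact
  note simps = diagram_simps[OF ind_objectD(1)[OF assms(2)]] diagram_simps[OF ind_objectD(1)[OF assms(3)]]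
  have "is_diagram C (ind_tens C X Y)"
    unfolding is_diagram_def ind_tens_def
    using category_prod_cat[OF ind_objectD(2)[OF assms(2)] ind_objectD(2)[OF assms(3)]]
    by (auto simp: simps interchange)
  then show ?thesis
    using filtered_prod_cat[OF ind_objectD(3)[OF assms(2)] ind_objectD(3)[OF assms(3)]]
    by (simp add: ind_object_def ind_tens_def)
qed

lemma ind_object_ind_of:
  assumes "category C" "A \<in> Obj C"
  shows "ind_object C (ind_of C A)"
proof -
  interpret category C by fact
  show ?thesis
    using filtered_one_cat assms(2)
    by (auto simp: ind_object_def is_diagram_def ind_of_def filtered_def)
qed

context closed_symmetric_monoidal_category
begin

lemma ind_object_ind_ihom:
  assumes W: "W \<in> Obj C" and V: "ind_object C V"
  shows "ind_object C (ind_ihom C W V)"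
  using V W ind_objectD(2,3)[OF V]
  by (auto simp: ind_object_def is_diagram_def ind_ihom_def diagram_simps[OF ind_objectD(1)[OF V]]
      ihom_arr_Id ihom_arr_Comp)

lemma ind_nat_map_levelwise:
  "ind_nat_map C W V =
    levelwise C (ind_tens C (ind_of C (dual C W)) V) (ind_ihom C W V) (\<lambda>j. nat_map C W (ob V j))"
  by (simp add: fun_eq_iff ind_nat_map_def levelwise_def ind_tens_def ind_of_def ind_ihom_def)

theorem nuclear_iff_trace_class:
  "nuclear C V \<longleftrightarrow> ind_object C V \<and>
    (\<forall>i \<in> Obj (Idx V). \<exists>k. \<exists>u \<in> hom (Idx V) i k. trace_class (ob V i) (ob V k) (ar V u))"
proof (cases "ind_object C V")
  case V: True
  note V_simps = diagram_simps[OF ind_objectD(1)[OF V]]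
  interpret J: category "Idx V"
    using ind_objectD[OF V] by simp
  let ?P = "\<lambda>W. ind_tens C (ind_of C (dual C W)) V" and ?Q = "\<lambda>W. ind_ihom C W V"
  let ?n = "\<lambda>W j. nat_map C W (ob V j)"
  have P: "ind_object C (?P W)" if "W \<in> Obj C" for W
    by (rule ind_object_ind_tens[OF _ ind_object_ind_of V]) (unfold_locales, use that in simp)
  have Q: "ind_object C (?Q W)" if "W \<in> Obj C" for W
    using that V by (rule ind_object_ind_ihom)
  have PQ: "Idx (?P W) = prod_cat one_cat (Idx (?Q W))"
    "Idx (?Q W) = Idx V" "ob (?P W) ((), j) = dual C W \<otimes> ob V j" "ob (?Q W) j = ihom C W (ob V j)"
    "ar (?P W) ((), u) = Id C (dual C W) \<star> ar V u" "ar (?Q W) u = ihom_arr C W (ar V u)"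
    for W j u
    by (simp_all add: ind_tens_def ind_of_def ind_ihom_def)
  have n_typed: "?n W j \<in> hom C (ob (?P W) ((), j)) (ob (?Q W) j)"
    if "W \<in> Obj C" "j \<in> Obj (Idx (?Q W))" for W j
    using that by (simp add: PQ V_simps)
  have n_natural: "?n W (Cod (Idx (?Q W)) u) \<cdot> ar (?P W) ((), u) = ar (?Q W) u \<cdot> ?n W (Dom (Idx (?Q W)) u)"
    if "W \<in> Obj C" "u \<in> Arr (Idx (?Q W))" for W u
    using that nat_map_natural[of W "ar V u"] by (simp add: PQ V_simps)
  have iso_imp_section: "\<exists>k. \<exists>w \<in> hom (Idx V) j k. \<exists>s \<in> hom C (ihom C W (ob V j)) (dual C W \<otimes> ob V k).
      nat_map C W (ob V k) \<cdot> s = ihom_arr C W (ar V w)"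
    if "ind_iso C (?P W) (?Q W) (ind_nat_map C W V)" "j \<in> Obj (Idx V)" "W \<in> Obj C" for W j
    using levelwise_iso_imp_section[OF P[OF that(3)] Q[OF that(3)] PQ(1)
      n_typed[OF that(3)] n_natural[OF that(3)], of j] that
    unfolding ind_nat_map_levelwise by (simp only: PQ)
  have sections_imp_iso: "ind_iso C (?P W) (?Q W) (ind_nat_map C W V)"
    if "W \<in> Obj C" "\<And>j. j \<in> Obj (Idx V) \<Longrightarrow> \<exists>k. \<exists>w \<in> hom (Idx V) j k.
      \<exists>s \<in> hom C (ihom C W (ob V j)) (dual C W \<otimes> ob V k).
      nat_map C W (ob V k) \<cdot> s = ihom_arr C W (ar V w) \<and>
      s \<cdot> nat_map C W (ob V j) = Id C (dual C W) \<star> ar V w" for W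
    unfolding ind_nat_map_levelwise
    by (rule sections_imp_levelwise_iso[OF P[OF that(1)] Q[OF that(1)] PQ(1)
      n_typed[OF that(1)] n_natural[OF that(1)]]) (simp_all only: PQ that(2))
  show ?thesis
  proof (intro iffI conjI V ballI)
    fix i assume "nuclear C V" and i: "i \<in> Obj (Idx V)"
    \<comment> \<open>Nuclearity is applied with the test object \<open>V\<^sub>i\<close> itself.\<close>
    then have "ind_iso C (?P (ob V i)) (?Q (ob V i)) (ind_nat_map C (ob V i) V)"
      unfolding nuclear_def by (simp add: V_simps)
    from iso_imp_section[OF this i] obtain k u s where u: "u \<in> hom (Idx V) i k"
      and s: "s \<in> hom C (ihom C (ob V i) (ob V i)) (dual C (ob V i) \<otimes> ob V k)"
      and eq: "nat_map C (ob V i) (ob V k) \<cdot> s = ihom_arr C (ob V i) (ar V u)"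
      using V_simps(1)[OF i] by blast
    have "trace_class (ob V i) (ob V k) (ar V u)"
      by (rule trace_class_of_factorization[OF _ _ _ s eq]) (use u in \<open>auto simp: V_simps\<close>)
    with u show "\<exists>k. \<exists>u \<in> hom (Idx V) i k. trace_class (ob V i) (ob V k) (ar V u)"
      by blast
  next
    assume tc: "ind_object C V \<and>
      (\<forall>i \<in> Obj (Idx V). \<exists>k. \<exists>u \<in> hom (Idx V) i k. trace_class (ob V i) (ob V k) (ar V u))"
    have "ind_iso C (?P W) (?Q W) (ind_nat_map C W V)" if W: "W \<in> Obj C" for W
    proof (rule sections_imp_iso[OF W])
      fix i assume i: "i \<in> Obj (Idx V)"
      then obtain k u where u: "u \<in> hom (Idx V) i k" and "trace_class (ob V i) (ob V k) (ar V u)"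
        using tc by blast
      moreover have "ob V i \<in> Obj C" "ob V k \<in> Obj C"
        using i u by (auto simp: V_simps)
      ultimately show "\<exists>k. \<exists>w \<in> hom (Idx V) i k.
        \<exists>s \<in> hom C (ihom C W (ob V i)) (dual C W \<otimes> ob V k).
        nat_map C W (ob V k) \<cdot> s = ihom_arr C W (ar V w) \<and>
        s \<cdot> nat_map C W (ob V i) = Id C (dual C W) \<star> ar V w"
        using factorization_of_trace_class[of "ob V i" "ob V k" "ar V u" W] W by blast
    qed
    then show "nuclear C V"
      using V by (simp add: nuclear_def)
  qed
qed (simp add: nuclear_def)

end

theorem lemma4p16:
  fixes C :: "('o, 'a) csm_cat"
    and X :: "('i, 'm, 'o, 'a) diagram"
    and Y :: "('j, 'n, 'o, 'a) diagram"
  assumes "closed_symmetric_monoidal_category C"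
    and "has_finite_limits C" and "has_finite_colimits C"
    and "nuclear C X" and "nuclear C Y"
  shows "nuclear C (ind_tens C X Y)"
proof -
  interpret closed_symmetric_monoidal_category C by fact
  have X: "ind_object C X" and Y: "ind_object C Y"
    using assms(4,5) by (simp_all add: nuclear_def)
  interpret I: category "Idx X" using ind_objectD[OF X] by simp
  interpret J: category "Idx Y" using ind_objectD[OF Y] by simp
  note simps = diagram_simps[OF ind_objectD(1)[OF X]] diagram_simps[OF ind_objectD(1)[OF Y]]
  show ?thesis
    unfolding nuclear_iff_trace_class
  proof (intro conjI ballI)
    show "ind_object C (ind_tens C X Y)"
      using X Y by (intro ind_object_ind_tens) unfold_locales
  next
    fix p assume "p \<in> Obj (Idx (ind_tens C X Y))"
    then obtain i j where p: "p = (i, j)" and ij: "i \<in> Obj (Idx X)" "j \<in> Obj (Idx Y)"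
      by (auto simp: ind_tens_def)
    obtain k u where u: "u \<in> hom (Idx X) i k" "trace_class (ob X i) (ob X k) (ar X u)"
      using assms(4) ij unfolding nuclear_iff_trace_class by blast
    obtain l v where v: "v \<in> hom (Idx Y) j l" "trace_class (ob Y j) (ob Y l) (ar Y v)"
      using assms(5) ij unfolding nuclear_iff_trace_class by blast
    have "trace_class (ob X i \<otimes>\<^bsub>C\<^esub> ob Y j) (ob X k \<otimes>\<^bsub>C\<^esub> ob Y l) (ar X u \<star>\<^bsub>C\<^esub> ar Y v)"
      by (rule trace_class_tens[OF u(2) v(2)]) (use u(1) v(1) in \<open>auto simp: simps\<close>)
    then show "\<exists>q. \<exists>w \<in> hom (Idx (ind_tens C X Y)) p q.
      trace_class (ob (ind_tens C X Y) p) (ob (ind_tens C X Y) q) (ar (ind_tens C X Y) w)"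
      using u(1) v(1) p by (intro exI[of _ "(k, l)"] bexI[of _ "(u, v)"]) (auto simp: ind_tens_def)
  qed
qed

end
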